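(* Let $0<q<1$, $\nu>-1$ and $\lambda\in\mathbb{R}_q^+$. Then $$c_{q,\nu}\,j_\nu(\lambda x;q^2)=\sum_{n=0}^\infty\mathcal{J}_{\nu,n}(\lambda;q^2)\,P_{\nu,n}(x;q^2),\qquad\forall x\in[0,1]\cap\mathbb{R}_q^+.$$ As a consequence, $$\sum_{n=0}^\infty\left[P_{\nu,n}(x;q^2)\right]^2=\frac{x^{-2(\nu+1)}}{1-q},\qquad\forall x\in[0,1]\cap\mathbb{R}_q^+,$$ and for all $\lambda\in\mathbb{R}_q^+$ $$\sum_{n=0}^\infty\left[\mathcal{J}_{\nu,n}(\lambda;q^2)\right]^2=-\frac{q^\nu}{2(1-q)\lambda^{1+2\nu}}\left[\frac{\lambda}{q}J_{\nu+1}(\lambda;q^2)J_\nu'(\lambda/q;q^2)-J_{\nu+1}(\lambda;q^2)J_\nu(\lambda/q;q^2)-J_{\nu+1}'(\lambda;q^2)J_\nu(\lambda/q;q^2)\right],$$ where $'$ denotes the derivative with respect to the first argument.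
   Context: $\mathbb{R}_q^+=\{q^n: n\in\mathbb{Z}\}$. $(a;q)_n=\prod_{k=0}^{n-1}(1-aq^{k})$, $(a;q)_\infty=\prod_{k\ge0}(1-aq^k)$, $(a,b;q)_\infty=(a;q)_\infty(b;q)_\infty$, and ${}_2\phi_1(a,b;c;q;z)=\sum_{k\ge0}\frac{(a;q)_k(b;q)_k}{(c;q)_k(q;q)_k}z^k$. Normalized $q$-Bessel function: $j_\nu(x;q^2)=\sum_{n=0}^\infty(-1)^n\frac{q^{n(n+1)}}{(q^{2\nu+2};q^2)_n(q^2;q^2)_n}x^{2n}$. The third Jackson (Hahn–Exton) $q$-Bessel function is $J_\nu(x;q^2)=\frac{(q^{2\nu+2};q^2)_\infty}{(q^2;q^2)_\infty}x^\nu j_\nu(x;q^2)$, $x>0$. Put $c_{q,\nu}=\frac{1}{1-q}\frac{(q^{2\nu+2};q^2)_\infty}{(q^2;q^2)_\infty}$ and $\sigma_{q,\nu}(n)=\sqrt{\frac{1-q^{2\nu+4n+2}}{1-q}}$. Little $q$-Jacobi polynomials: $p_n(x;q^\nu,q^\beta;q)={}_2\phi_1(q^{n+\nu+\beta+1},q^{-n};q^{\nu+1};q;qx)$; thus $p_n(x^2;q^{2\nu},1;q^2)={}_2\phi_1(q^{2n+2\nu+2},q^{-2n};q^{2\nu+2};q^2;q^2x^2)$. For $n=0,1,2,\dots$ define $$P_{\nu,n}(x;q^2)=\sigma_{q,\nu}(n)\,q^{-n(\nu+1)}\frac{(q^{2+2n},q^{2\nu+2};q^2)_\infty}{(q^{2+2n+2\nu},q^2;q^2)_\infty}\,p_n(x^2;q^{2\nu},1;q^2),\qquad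 \mathcal{J}_{\nu,n}(x;q^2)=\sigma_{q,\nu}(n)\frac{J_{\nu+2n+1}(q^nx;q^2)}{x^{\nu+1}}.$$
   Formalization: In the third identity the last bracket term is taken as λ J'_{ν+1}(λ;q²) J_ν(λ/q;q²); the printed formula omits the factor λ and fails, for example, for λ = q^k with k large. The two forms agree at λ = 1. *)

theory Defs
  imports "HOL-Analysis.Analysis"
begin

definition qgrid :: "real \<Rightarrow> real set" where
  "qgrid q = {q powi n | n :: int. True}"

definition qpoch :: "real \<Rightarrow> real \<Rightarrow> nat \<Rightarrow> real" where
  "qpoch a q n = (\<Prod>k<n. 1 - a * q ^ k)"

definition qpoch_inf :: "real \<Rightarrow> real \<Rightarrow> real" where
  "qpoch_inf a q = (\<Prod>k. 1 - a * q ^ k)"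

definition phi21 :: "real \<Rightarrow> real \<Rightarrow> real \<Rightarrow> real \<Rightarrow> real \<Rightarrow> real" where
  "phi21 a b c q z =
     (\<Sum>k. qpoch a q k * qpoch b q k / (qpoch c q k * qpoch q q k) * z ^ k)"

(* The functions written f(x; q^2) in the literature take q, not q^2, as their
   parameter below, since q^n with odd n and q^nu also occur. *)

definition norm_qbessel :: "real \<Rightarrow> real \<Rightarrow> real \<Rightarrow> real" where
  "norm_qbessel q \<nu> x =
     (\<Sum>n. (-1) ^ n * (q ^ (n * (n + 1)) /
            (qpoch (q powr (2 * \<nu> + 2)) (q\<^sup>2) n * qpoch (q\<^sup>2) (q\<^sup>2) n)) * x ^ (2 * n))"

(* third Jackson q-Bessel function J_nu(x; q^2), meaningful for x > 0 *)
definition hahn_exton_J :: "real \<Rightarrow> real \<Rightarrow> real \<Rightarrow> real" where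
  "hahn_exton_J q \<nu> x =
     qpoch_inf (q powr (2 * \<nu> + 2)) (q\<^sup>2) / qpoch_inf (q\<^sup>2) (q\<^sup>2) * x powr \<nu> * norm_qbessel q \<nu> x"

definition c_const :: "real \<Rightarrow> real \<Rightarrow> real" where
  "c_const q \<nu> =
     1 / (1 - q) * (qpoch_inf (q powr (2 * \<nu> + 2)) (q\<^sup>2) / qpoch_inf (q\<^sup>2) (q\<^sup>2))"

definition sigma_const :: "real \<Rightarrow> real \<Rightarrow> nat \<Rightarrow> real" where
  "sigma_const q \<nu> n = sqrt ((1 - q powr (2 * \<nu> + 4 * real n + 2)) / (1 - q))"

(* p_n(x; a, b; q); with a = q^nu and b = q^beta the parameters of the series are
   q^(n+nu+beta+1), q^(-n) and q^(nu+1) *)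
definition little_q_jacobi :: "nat \<Rightarrow> real \<Rightarrow> real \<Rightarrow> real \<Rightarrow> real \<Rightarrow> real" where
  "little_q_jacobi n x a b q =
     phi21 (a * b * q ^ (n + 1)) (q powi (- int n)) (a * q) q (q * x)"

definition P_fun :: "real \<Rightarrow> real \<Rightarrow> nat \<Rightarrow> real \<Rightarrow> real" where
  "P_fun q \<nu> n x =
     sigma_const q \<nu> n * q powr (- real n * (\<nu> + 1)) *
     ((qpoch_inf (q ^ (2 + 2 * n)) (q\<^sup>2) * qpoch_inf (q powr (2 * \<nu> + 2)) (q\<^sup>2)) /
      (qpoch_inf (q powr (2 + 2 * real n + 2 * \<nu>)) (q\<^sup>2) * qpoch_inf (q\<^sup>2) (q\<^sup>2))) *
     little_q_jacobi n (x\<^sup>2) (q powr (2 * \<nu>)) 1 (q\<^sup>2)"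

definition J_fun :: "real \<Rightarrow> real \<Rightarrow> nat \<Rightarrow> real \<Rightarrow> real" where
  "J_fun q \<nu> n x =
     sigma_const q \<nu> n * (hahn_exton_J q (\<nu> + 2 * real n + 1) (q ^ n * x) / x powr (\<nu> + 1))"

(* Convention for the closed form of the sum over n of (J_fun q nu n l)^2: its bracket is minus
   the derivative at a = l/q of a * J_(nu+1)(q*a) * J_nu(b) - b * J_(nu+1)(q*b) * J_nu(a),
   b = l/q held fixed, so the last term carries the chain-rule factor l. The printed source
   omits this factor, and its formula fails for l different from 1. *)

end

theory Submission
  imports Defs
begin

text \<open>
  Put \<open>p = q\<^sup>2\<close> and \<open>a = q powr (2 * \<nu> + 2)\<close>. On the grid \<open>x = q ^ m\<close> with weights
  \<open>(1 - q) * a ^ m\<close> the functions \<open>P_fun q \<nu> n\<close> are orthonormal polynomials in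
  \<open>x\<^sup>2 = p ^ m\<close>, and \<open>J_fun q \<nu> n l\<close> are the Fourier coefficients of
  \<open>c_const q \<nu> * norm_qbessel q \<nu> (l * x)\<close>; both facts follow from one partial
  fraction decomposition, which evaluates the moments of the little \<open>q\<close>-Jacobi polynomials.
  The point masses are uniform limits on the grid of
  \<open>(x\<^sup>2 / p ^ k) ^ M * (\<Prod>i<k. 1 - x\<^sup>2 / p ^ i)\<close> (normalized at \<open>x = q ^ k\<close>) as \<open>M\<close> grows,
  and the Bessel function is the uniform limit of its Taylor polynomials, so Parseval's
  identity holds for both; the three sums are the three inner products of these two
  functions. The norm of the Bessel function is found by telescoping, from the
  \<open>q\<close>-difference equation and its derivative.
\<close>

section \<open>q-shifted factorials and partial fractions\<close>

lemma qpoch_0 [simp]: "qpoch a q 0 = 1"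
  by (simp add: qpoch_def)

lemma qpoch_Suc: "qpoch a q (Suc n) = qpoch a q n * (1 - a * q ^ n)"
  by (simp add: qpoch_def)

lemma qpoch_Suc_shift: "qpoch a q (Suc n) = (1 - a) * qpoch (a * q) q n"
  unfolding qpoch_def by (subst prod.lessThan_Suc_shift) (simp add: mult_ac)

lemma qpoch_add: "qpoch a q (m + n) = qpoch a q m * qpoch (a * q ^ m) q n"
  by (induction n) (simp_all add: qpoch_Suc power_add mult_ac)

lemma qpoch_pos:
  assumes "0 < q" "q < 1" "a < 1"
  shows "qpoch a q n > 0"
proof -
  have "a * q ^ k < 1" for k
  proof (cases "a \<le> 0")
    case True
    have "a * q ^ k \<le> 0" using True assms(1) by (intro mult_nonpos_nonneg) auto
    then show ?thesis by linarith
  next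
    case False
    have "a * q ^ k \<le> a * 1" using False assms by (intro mult_left_mono power_le_one) auto
    then show ?thesis using assms(3) by linarith
  qed
  then show ?thesis unfolding qpoch_def by (intro prod_pos) auto
qed

text \<open>The factor with index \<open>n\<close> is zero; this is what makes the series of the
  little q-Jacobi polynomials terminate.\<close>

lemma qpoch_inverse_power_eq_0:
  assumes "q \<noteq> 0" "n < j"
  shows "qpoch (q powi (- int n)) q j = 0"
  unfolding qpoch_def
  by (rule prod_zero[OF finite_lessThan], rule bexI[of _ n])
     (use assms in \<open>auto simp: power_int_minus\<close>)

lemma convergent_prod_qpoch:
  fixes a q :: real
  assumes "0 < q" "q < 1"
  shows "convergent_prod (\<lambda>k. 1 - a * q ^ k)"
proof (intro abs_convergent_prod_imp_convergent_prod summable_imp_abs_convergent_prod)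
  show "summable (\<lambda>i. norm (1 - a * q ^ i - 1))"
    using assms by (simp add: abs_mult power_abs summable_mult summable_geometric)
qed

lemma qpoch_inf_split:
  assumes "0 < q" "q < 1"
  shows "qpoch_inf a q = qpoch a q n * qpoch_inf (a * q ^ n) q"
  using has_prod_unique[OF has_prod_ignore_initial_segment'[OF convergent_prod_qpoch[OF assms, of a], of n]]
  by (simp add: qpoch_inf_def qpoch_def power_add mult_ac)

lemma qpoch_inf_neq_0:
  assumes "0 < q" "q < 1" "a < 1"
  shows "qpoch_inf a q \<noteq> 0"
  unfolding qpoch_inf_def
proof (rule prodinf_nonzero[OF convergent_prod_qpoch[OF assms(1,2)]])
  fix k
  show "1 - a * q ^ k \<noteq> 0"
    using qpoch_pos[OF assms, of "Suc k"] by (auto simp: qpoch_Suc)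
qed

text \<open>Partial fraction decomposition in \<open>z\<close>: both sides, multiplied by the common
  denominator, are polynomials of degree at most \<open>n\<close> agreeing at the \<open>n + 1\<close> poles
  \<open>z = p^(-j)\<close>.\<close>

lemma qpoch_partial_fractions:
  fixes a p z :: real
  assumes p: "0 < p" "p < 1" and a: "a < 1" and z: "z < 1"
  shows "(\<Sum>j\<le>n. qpoch (a * p ^ n) p j * qpoch (p powi (- int n)) p j * p ^ j /
            (qpoch a p j * qpoch p p j) / (1 - z * p ^ j)) =
         qpoch p p n / qpoch a p n * (\<Prod>i<n. z - a * p ^ i) / qpoch z p (Suc n)"
proof -
  define r where "r j = qpoch (a * p ^ n) p j * qpoch (p powi (- int n)) p j * p ^ j /
            (qpoch a p j * qpoch p p j)" for j
  define L where "L = (\<Sum>j\<le>n. smult (r j) (\<Prod>i\<in>{..n}-{j}. [:1, - (p ^ i):]))"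
  define R where "R = smult (qpoch p p n / qpoch a p n) (\<Prod>i<n. [:- a * p ^ i, 1:])"
  have pj: "qpoch p p j > 0" "qpoch a p j > 0" for j using p a by (auto intro!: qpoch_pos)
  have poly_L: "poly L y = (\<Sum>j\<le>n. r j * (\<Prod>i\<in>{..n}-{j}. 1 - y * p ^ i))" for y
    by (simp add: L_def poly_sum poly_prod)
  have poly_R: "poly R y = qpoch p p n / qpoch a p n * (\<Prod>i<n. y - a * p ^ i)" for y
    by (simp add: R_def poly_prod)
  \<comment> \<open>At the node p^(-j) only the j-th summand of \<open>L\<close> survives. Its
    product splits into the factors with index below \<open>j\<close> (\<open>low\<close>) and above
    \<open>j\<close> (\<open>high\<close>).\<close>
  have at_node: "poly L (inverse (p ^ j)) = poly R (inverse (p ^ j))" if j: "j \<le> n" for j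
  proof -
    \<comment> \<open>The factors are 1 - p^(-k) for k = 1, ..., j. Multiplying each by p^k turns it
      into -(1 - p^k), and these exponents add up to j(j+1)/2.\<close>
    have low: "(\<Prod>i<j. 1 - inverse (p ^ j) * p ^ i) * p ^ (j * (j + 1) div 2) = (-1) ^ j * qpoch p p j" for j
    proof (induction j)
      case (Suc j)
      have "(\<Prod>i<Suc j. 1 - inverse (p ^ Suc j) * p ^ i) =
            (1 - inverse (p ^ Suc j)) * (\<Prod>i<j. 1 - inverse (p ^ j) * p ^ i)"
        using p by (subst prod.lessThan_Suc_shift) (simp add: field_simps)
      moreover have "Suc j * (Suc j + 1) div 2 = Suc j + j * (j + 1) div 2"
        by simp
      ultimately have "(\<Prod>i<Suc j. 1 - inverse (p ^ Suc j) * p ^ i) * p ^ (Suc j * (Suc j + 1) div 2)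
          = ((1 - inverse (p ^ Suc j)) * p ^ Suc j) *
            ((\<Prod>i<j. 1 - inverse (p ^ j) * p ^ i) * p ^ (j * (j + 1) div 2))"
        by (simp only: power_add mult_ac)
      also have "(1 - inverse (p ^ Suc j)) * p ^ Suc j = - (1 - p * p ^ j)"
        using p by (simp add: field_simps)
      also note Suc.IH
      finally show ?case by (simp only: qpoch_Suc power_Suc) (simp add: algebra_simps)
    qed simp
    have high: "(\<Prod>i\<in>{j<..n}. 1 - inverse (p ^ j) * p ^ i) = qpoch p p (n - j)"
      unfolding qpoch_def
      by (rule prod.reindex_bij_witness[of _ "\<lambda>i. i + Suc j" "\<lambda>i. i - Suc j"])
         (use p in \<open>auto simp: power_add field_simps power_diff\<close>)
    have split: "{..n} - {j} = {..<j} \<union> {j<..n}" using j by auto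
    \<comment> \<open>Reversing the order of the factors of (p^(-n); p)_j gives the top
      \<open>j\<close> factors of \<open>qpoch p p n\<close>, up to sign and a power of
      \<open>p\<close>; the factor from \<open>high\<close> supplies the others.\<close>
    have num: "qpoch (p powi (- int n)) p j * qpoch p p (n - j) * p ^ (n * j) =
               (-1) ^ j * p ^ (j * (j - 1) div 2) * qpoch p p n" using j
    proof (induction j)
      case (Suc j)
      have e1: "n - j = Suc (n - Suc j)" using Suc.prems by simp
      have e2: "Suc j * (Suc j - 1) div 2 = j + j * (j - 1) div 2"
        by (cases j) simp_all
      have e3: "(1 - p powi (- int n) * p ^ j) * p ^ n = - (p ^ j) * (1 - p * p ^ (n - Suc j))"
      proof -
        have "p ^ n = p ^ j * (p * p ^ (n - Suc j))"
          using Suc.prems by (simp flip: power_Suc power_add)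
        then show ?thesis using p by (simp add: power_int_minus field_simps)
      qed
      have "qpoch (p powi (- int n)) p (Suc j) * qpoch p p (n - Suc j) * p ^ (n * Suc j) =
         qpoch (p powi (- int n)) p j * qpoch p p (n - Suc j) * p ^ (n * j) *
           ((1 - p powi (- int n) * p ^ j) * p ^ n)"
        by (simp add: qpoch_Suc power_add mult_ac)
      also have "\<dots> = - (p ^ j) * (qpoch (p powi (- int n)) p j * (qpoch p p (n - Suc j) * (1 - p * p ^ (n - Suc j))) * p ^ (n * j))"
        unfolding e3 by (simp add: mult_ac)
      also have "qpoch p p (n - Suc j) * (1 - p * p ^ (n - Suc j)) = qpoch p p (n - j)"
        unfolding e1 by (simp add: qpoch_Suc)
      finally show ?case using Suc unfolding e2 by (simp add: power_add mult_ac)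
    qed simp
    \<comment> \<open>Both sides equal \<open>qpoch a p (n + j)\<close>.\<close>
    have sym: "qpoch (a * p ^ n) p j * qpoch a p n = qpoch (a * p ^ j) p n * qpoch a p j"
      using qpoch_add[of a p n j] qpoch_add[of a p j n] by (simp add: add.commute mult_ac)
    have rhs: "(\<Prod>i<n. inverse (p ^ j) - a * p ^ i) * p ^ (n * j) = qpoch (a * p ^ j) p n"
    proof -
      have "(\<Prod>i<n. inverse (p ^ j) - a * p ^ i) * (\<Prod>i<n. p ^ j) = qpoch (a * p ^ j) p n"
        unfolding qpoch_def prod.distrib[symmetric]
        by (rule prod.cong) (use p in \<open>auto simp: field_simps\<close>)
      then show ?thesis by (simp add: power_mult[symmetric] mult.commute)
    qed
    have tri: "j * (j + 1) div 2 = j + j * (j - 1) div 2"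
      by (cases j) simp_all
    have "poly L (inverse (p ^ j)) = r j * (\<Prod>i\<in>{..n}-{j}. 1 - inverse (p ^ j) * p ^ i)"
    proof -
      have "r i * (\<Prod>k\<in>{..n}-{i}. 1 - inverse (p ^ j) * p ^ k) = 0" if "i \<noteq> j" for i
        using that j p by (auto intro!: bexI[of _ j])
      then have "poly L (inverse (p ^ j)) =
          (\<Sum>i\<le>n. if i = j then r j * (\<Prod>k\<in>{..n}-{j}. 1 - inverse (p ^ j) * p ^ k) else 0)"
        unfolding poly_L by (intro sum.cong) auto
      then show ?thesis using j by simp
    qed
    also have "(\<Prod>i\<in>{..n}-{j}. 1 - inverse (p ^ j) * p ^ i) =
       (\<Prod>i<j. 1 - inverse (p ^ j) * p ^ i) * qpoch p p (n - j)"
      unfolding split by (subst prod.union_disjoint) (auto simp flip: high)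
    finally have "poly L (inverse (p ^ j)) * p ^ (n * j) * p ^ (j * (j + 1) div 2) =
       qpoch (a * p ^ n) p j * p ^ j / (qpoch a p j * qpoch p p j) *
       (qpoch (p powi (- int n)) p j * qpoch p p (n - j) * p ^ (n * j)) *
       ((\<Prod>i<j. 1 - inverse (p ^ j) * p ^ i) * p ^ (j * (j + 1) div 2))"
      by (simp add: r_def mult_ac)
    also have "\<dots> = qpoch (a * p ^ n) p j * (p ^ j * p ^ (j * (j - 1) div 2)) / (qpoch a p j * qpoch p p j) *
       (qpoch p p n * qpoch p p j) * ((-1) ^ j * (-1) ^ j)"
      unfolding num low by (simp add: mult_ac)
    also have "\<dots> = qpoch (a * p ^ n) p j / qpoch a p j * qpoch p p n * p ^ (j * (j + 1) div 2)"
      using pj[of j] unfolding tri by (simp add: power_add flip: power_mult_distrib)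
    also have "qpoch (a * p ^ n) p j / qpoch a p j = qpoch (a * p ^ j) p n / qpoch a p n"
      using sym pj[of j] pj[of n] by (simp add: field_simps)
    also have "\<dots> * qpoch p p n = poly R (inverse (p ^ j)) * p ^ (n * j)"
      unfolding poly_R rhs[symmetric] by simp
    finally show ?thesis using p by simp
  qed
  have "L = R"
  proof (rule poly_eqI_degree)
    show "poly L y = poly R y" if "y \<in> (\<lambda>j. inverse (p ^ j)) ` {..n}" for y
      using that at_node by auto
    have "inj_on (\<lambda>j. inverse (p ^ j)) {..n}"
      using p by (intro inj_onI) (simp add: power_inject_exp')
    then have c: "card ((\<lambda>j. inverse (p ^ j)) ` {..n}) = Suc n" by (simp add: card_image)
    have "degree L \<le> n" unfolding L_def
    proof (intro degree_sum_le finite_atMost)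
      fix j assume j: "j \<in> {..n}"
      have "degree (\<Prod>i\<in>{..n}-{j}. [:1, - (p ^ i):]) \<le> (\<Sum>i\<in>{..n}-{j}. degree [:1, - (p ^ i):])"
        using degree_prod_sum_le[of "{..n}-{j}" "\<lambda>i. [:1, - (p ^ i):]"] by (simp add: o_def)
      also have "\<dots> \<le> (\<Sum>i\<in>{..n}-{j}. 1)" by (intro sum_mono) simp
      also have "\<dots> = n" using j by simp
      finally show "degree (smult (r j) (\<Prod>i\<in>{..n}-{j}. [:1, - (p ^ i):])) \<le> n"
        by (rule order.trans[OF degree_smult_le])
    qed
    then show "degree L < card ((\<lambda>j. inverse (p ^ j)) ` {..n})" using c by simp
    have "degree (\<Prod>i<n. [:- a * p ^ i, 1:]) \<le> (\<Sum>i<n. degree [:- a * p ^ i, 1:])"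
      using degree_prod_sum_le[of "{..<n}" "\<lambda>i. [:- a * p ^ i, 1:]"] by (simp add: o_def)
    also have "\<dots> = n" by simp
    finally have "degree R \<le> n" unfolding R_def by (rule order.trans[OF degree_smult_le])
    then show "degree R < card ((\<lambda>j. inverse (p ^ j)) ` {..n})" using c by simp
  qed
  have zn: "1 - z * p ^ j \<noteq> 0" for j
    using qpoch_pos[OF p z, of "Suc j"] by (auto simp: qpoch_Suc)
  have "(\<Sum>j\<le>n. r j / (1 - z * p ^ j)) = poly L z / qpoch z p (Suc n)"
    unfolding poly_L sum_divide_distrib
  proof (rule sum.cong)
    fix j assume "j \<in> {..n}"
    then have "qpoch z p (Suc n) = (1 - z * p ^ j) * (\<Prod>i\<in>{..n}-{j}. 1 - z * p ^ i)"
      unfolding qpoch_def lessThan_Suc_atMost by (intro prod.remove) auto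
    moreover have "(\<Prod>i\<in>{..n}-{j}. 1 - z * p ^ i) \<noteq> 0" using zn by simp
    ultimately show "r j / (1 - z * p ^ j) =
       r j * (\<Prod>i\<in>{..n}-{j}. 1 - z * p ^ i) / qpoch z p (Suc n)"
      by simp
  qed simp
  then show ?thesis unfolding \<open>L = R\<close> poly_R r_def by simp
qed

section \<open>Parseval identity for orthonormal polynomials on a discrete set\<close>

text \<open>The uniform closure of the polynomials on the points \<open>x m\<close>. For points in
  [0,1] and a summable weight, membership yields boundedness, convergence of inner products, and
  approximation in the weighted norm.\<close>

definition poly_approximable :: "(nat \<Rightarrow> real) \<Rightarrow> (nat \<Rightarrow> real) \<Rightarrow> bool" where
  "poly_approximable x f \<longleftrightarrow> (\<forall>\<epsilon>>0. \<exists>P. \<forall>m. \<bar>f m - poly P (x m)\<bar> \<le> \<epsilon>)"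

lemma poly_approximable_poly: "poly_approximable x (\<lambda>m. poly P (x m))"
  unfolding poly_approximable_def by (intro allI impI exI[of _ P]) simp

lemma poly_approximable_add:
  assumes "poly_approximable x f" "poly_approximable x g"
  shows "poly_approximable x (\<lambda>m. f m + g m)"
  unfolding poly_approximable_def
proof (intro allI impI)
  fix \<epsilon> :: real assume "\<epsilon> > 0"
  then obtain P Q where "\<forall>m. \<bar>f m - poly P (x m)\<bar> \<le> \<epsilon> / 2" "\<forall>m. \<bar>g m - poly Q (x m)\<bar> \<le> \<epsilon> / 2"
    using assms unfolding poly_approximable_def by (meson half_gt_zero)
  then have "\<forall>m. \<bar>f m + g m - poly (P + Q) (x m)\<bar> \<le> \<epsilon>"
    by (auto simp: abs_le_iff algebra_simps) (smt (verit) field_sum_of_halves)+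
  then show "\<exists>P. \<forall>m. \<bar>f m + g m - poly P (x m)\<bar> \<le> \<epsilon>" by blast
qed

lemma poly_approximable_cmult:
  assumes "poly_approximable x f"
  shows "poly_approximable x (\<lambda>m. c * f m)"
  unfolding poly_approximable_def
proof (intro allI impI)
  fix \<epsilon> :: real assume e: "\<epsilon> > 0"
  then obtain P where P: "\<forall>m. \<bar>f m - poly P (x m)\<bar> \<le> \<epsilon> / (\<bar>c\<bar> + 1)"
    using assms unfolding poly_approximable_def
    by (metis abs_ge_zero add_nonneg_pos divide_pos_pos zero_less_one)
  have "\<bar>c * f m - poly (smult c P) (x m)\<bar> \<le> \<epsilon>" for m
  proof -
    have "\<bar>c * f m - poly (smult c P) (x m)\<bar> = \<bar>c\<bar> * \<bar>f m - poly P (x m)\<bar>"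
      by (simp add: abs_mult flip: right_diff_distrib)
    also have "\<dots> \<le> \<bar>c\<bar> * (\<epsilon> / (\<bar>c\<bar> + 1))" using P by (intro mult_left_mono) auto
    also have "\<dots> \<le> \<epsilon>" using e by (simp add: field_simps)
    finally show ?thesis .
  qed
  then show "\<exists>P. \<forall>m. \<bar>c * f m - poly P (x m)\<bar> \<le> \<epsilon>" by blast
qed

lemma poly_approximable_uniform_limit:
  assumes "uniform_limit UNIV T f sequentially" "\<And>k. poly_approximable x (T k)"
  shows "poly_approximable x f"
  unfolding poly_approximable_def
proof (intro allI impI)
  fix \<epsilon> :: real assume e: "\<epsilon> > 0"
  have "eventually (\<lambda>k. \<forall>m\<in>UNIV. dist (T k m) (f m) < \<epsilon> / 2) sequentially"
    using uniform_limitD[OF assms(1), of "\<epsilon> / 2"] e by simp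
  then obtain k where k: "\<And>m. dist (T k m) (f m) < \<epsilon> / 2"
    unfolding eventually_sequentially by auto
  obtain P where P: "\<And>m. \<bar>T k m - poly P (x m)\<bar> \<le> \<epsilon> / 2"
    using assms(2)[of k] half_gt_zero[OF e] unfolding poly_approximable_def by blast
  have "\<bar>f m - poly P (x m)\<bar> \<le> \<epsilon>" for m
    using k[of m] P[of m] unfolding dist_real_def by arith
  then show "\<exists>P. \<forall>m. \<bar>f m - poly P (x m)\<bar> \<le> \<epsilon>" by blast
qed

lemma poly_bounded_unit:
  fixes P :: "real poly"
  obtains B where "B \<ge> 0" "\<And>y. 0 \<le> y \<Longrightarrow> y \<le> 1 \<Longrightarrow> \<bar>poly P y\<bar> \<le> B"
proof -
  have "compact (poly P ` {0..1})"
    by (intro compact_continuous_image continuous_intros) auto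
  then obtain B where "\<forall>z\<in>poly P ` {0..1}. norm z \<le> B"
    using compact_imp_bounded bounded_iff by blast
  then have "\<bar>poly P y\<bar> \<le> max B 0" if "0 \<le> y" "y \<le> 1" for y
    using that by (auto simp: le_max_iff_disj)
  then show ?thesis using that by (metis max.cobounded2)
qed

text \<open>The system is triangular: subtracting a multiple of \<open>E N\<close> cancels the
  coefficient of degree \<open>N\<close>, and the induction hypothesis handles the
  remainder.\<close>

lemma poly_span_degree:
  fixes E :: "nat \<Rightarrow> real poly"
  assumes deg: "\<And>n. degree (E n) \<le> n" and lead: "\<And>n. coeff (E n) n \<noteq> 0"
  shows "degree P < N \<Longrightarrow> \<exists>c. P = (\<Sum>n<N. smult (c n) (E n))"
proof (induction N arbitrary: P)
  case (Suc N)
  define k where "k = coeff P N / coeff (E N) N"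
  define Q where "Q = P - smult k (E N)"
  have dQ: "coeff Q i = 0" if "i \<ge> N" for i
  proof (cases "i = N")
    case True
    then show ?thesis using lead[of N] by (simp add: Q_def k_def)
  next
    case False
    then show ?thesis
      using that Suc.prems deg[of N] by (simp add: Q_def coeff_eq_0)
  qed
  have "\<exists>c. Q = (\<Sum>n<N. smult (c n) (E n))"
  \<comment> \<open>The zero polynomial has degree 0, so \<open>degree Q < N\<close> cannot express
    \<open>Q = 0\<close> when \<open>N = 0\<close>; that case is separate.\<close>
  proof (cases "N = 0")
    case True
    then have "Q = 0" using dQ by (intro poly_eqI) simp
    then show ?thesis using True by simp
  next
    case False
    then have "degree Q < N" using dQ by (intro degree_lessI) auto
    then show ?thesis by (rule Suc.IH)
  qed
  then obtain c where "Q = (\<Sum>n<N. smult (c n) (E n))" ..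
  then have "P = (\<Sum>n<N. smult (c n) (E n)) + smult k (E N)"
    unfolding Q_def by (simp add: diff_eq_eq)
  also have "\<dots> = (\<Sum>n<Suc N. smult ((c(N := k)) n) (E n))" by simp
  finally show ?case by blast
qed simp

section \<open>Weighted inner products and Parseval's identity\<close>

locale discrete_orthonormal_polys =
  fixes w x :: "nat \<Rightarrow> real" and E :: "nat \<Rightarrow> real poly"
  assumes w_nonneg: "w m \<ge> 0" and w_summable: "summable w"
    and x_ge_0: "0 \<le> x m" and x_le_1: "x m \<le> 1"
    and degree_E: "degree (E n) \<le> n" and coeff_E: "coeff (E n) n \<noteq> 0"
    and orthonormal: "(\<Sum>m. w m * (poly (E n) (x m) * poly (E k) (x m))) = (if n = k then 1 else 0)"
begin

lemma summable_weighted: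
  assumes "\<And>m. \<bar>f m\<bar> \<le> B"
  shows "summable (\<lambda>m. w m * f m)"
proof (rule summable_comparison_test)
  show "\<exists>N. \<forall>m\<ge>N. norm (w m * f m) \<le> w m * B"
    using assms w_nonneg by (auto simp: abs_mult intro!: mult_left_mono)
  show "summable (\<lambda>m. w m * B)" by (intro summable_mult2 w_summable)
qed

lemma poly_approximable_bounded:
  assumes "poly_approximable x f"
  obtains B where "B \<ge> 0" "\<And>m. \<bar>f m\<bar> \<le> B"
proof -
  obtain P where P: "\<forall>m. \<bar>f m - poly P (x m)\<bar> \<le> 1"
    using assms unfolding poly_approximable_def using zero_less_one by blast
  obtain B where B: "B \<ge> 0" "\<And>y. 0 \<le> y \<Longrightarrow> y \<le> 1 \<Longrightarrow> \<bar>poly P y\<bar> \<le> B"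
    using poly_bounded_unit by blast
  have "\<bar>f m\<bar> \<le> B + 1" for m
    using P[rule_format, of m] B(2)[OF x_ge_0 x_le_1, of m] by linarith
  then show ?thesis using that[of "B + 1"] B(1) by simp
qed

lemma summable_ip:
  assumes "poly_approximable x f" "poly_approximable x g"
  shows "summable (\<lambda>m. w m * (f m * g m))"
proof -
  obtain B C where "B \<ge> 0" "\<And>m. \<bar>f m\<bar> \<le> B" "C \<ge> 0" "\<And>m. \<bar>g m\<bar> \<le> C"
    using assms poly_approximable_bounded by metis
  then have "\<bar>f m * g m\<bar> \<le> B * C" for m by (simp add: abs_mult mult_mono)
  then show ?thesis by (rule summable_weighted)
qed

definition ip :: "(nat \<Rightarrow> real) \<Rightarrow> (nat \<Rightarrow> real) \<Rightarrow> real" where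
  "ip f g = (\<Sum>m. w m * (f m * g m))"

abbreviation e :: "nat \<Rightarrow> nat \<Rightarrow> real" where
  "e n m \<equiv> poly (E n) (x m)"

lemma ip_commute: "ip f g = ip g f"
  by (simp add: ip_def mult.commute)

lemma ip_add:
  assumes "poly_approximable x f" "poly_approximable x g" "poly_approximable x h"
  shows "ip (\<lambda>m. f m + g m) h = ip f h + ip g h"
  unfolding ip_def
  using suminf_add[OF summable_ip[OF assms(1,3)] summable_ip[OF assms(2,3)]]
  by (simp add: algebra_simps)

lemma ip_cmult:
  assumes "poly_approximable x f" "poly_approximable x h"
  shows "ip (\<lambda>m. c * f m) h = c * ip f h"
  unfolding ip_def
  using suminf_mult[OF summable_ip[OF assms], of c]
  by (simp add: mult_ac)

lemma ip_nonneg: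
  assumes "poly_approximable x f"
  shows "ip f f \<ge> 0"
  unfolding ip_def
  by (intro suminf_nonneg summable_ip assms mult_nonneg_nonneg[OF w_nonneg zero_le_square])

lemma ip_le:
  assumes "poly_approximable x f" "\<And>m. \<bar>f m\<bar> \<le> \<epsilon>"
  shows "ip f f \<le> suminf w * \<epsilon>\<^sup>2"
proof -
  have "ip f f \<le> (\<Sum>m. w m * \<epsilon>\<^sup>2)"
    unfolding ip_def
  proof (intro suminf_le summable_ip assms summable_mult2 w_summable mult_left_mono w_nonneg)
    fix m
    show "f m * f m \<le> \<epsilon>\<^sup>2"
      using power_mono[OF assms(2)[of m] abs_ge_zero, of 2] by (simp add: power2_eq_square)
  qed
  then show ?thesis by (simp add: suminf_mult2[OF w_summable])
qed

text \<open>The weight has finite total mass and \<open>h\<close> is bounded, so a uniform error in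
  the first argument gives a proportionally small error in the inner product.\<close>

lemma ip_uniform_limit:
  assumes T: "uniform_limit UNIV T f sequentially" "\<And>k. poly_approximable x (T k)"
    and h: "poly_approximable x h"
  shows "(\<lambda>k. ip (T k) h) \<longlonglongrightarrow> ip f h"
proof (rule LIMSEQ_I)
  fix r :: real assume r: "r > 0"
  have f: "poly_approximable x f" by (rule poly_approximable_uniform_limit[OF T])
  obtain B where B: "B \<ge> 0" "\<And>m. \<bar>h m\<bar> \<le> B" using poly_approximable_bounded[OF h] by blast
  have W: "suminf w \<ge> 0" using w_nonneg w_summable by (intro suminf_nonneg) auto
  \<comment> \<open>The summand 1 keeps the denominator positive and makes the final bound
    strict.\<close>
  define \<epsilon> where "\<epsilon> = r / (suminf w * B + 1)"
  have e: "\<epsilon> > 0" using r W B(1) by (auto simp: \<epsilon>_def intro!: divide_pos_pos add_nonneg_pos)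
  obtain N where N: "\<And>k m. k \<ge> N \<Longrightarrow> dist (T k m) (f m) < \<epsilon>"
    using uniform_limitD[OF T(1) e] unfolding eventually_sequentially by auto
  have "norm (ip (T k) h - ip f h) < r" if "k \<ge> N" for k
  proof -
    have d: "(\<lambda>m. w m * (T k m * h m) - w m * (f m * h m)) sums (ip (T k) h - ip f h)"
      unfolding ip_def by (intro sums_diff summable_sums summable_ip T(2) f h)
    have b: "norm (w m * (T k m * h m) - w m * (f m * h m)) \<le> w m * (\<epsilon> * B)" for m
    proof -
      have "norm (w m * (T k m * h m) - w m * (f m * h m)) = w m * (\<bar>T k m - f m\<bar> * \<bar>h m\<bar>)"
        using w_nonneg[of m] by (simp add: abs_mult flip: right_diff_distrib left_diff_distrib)
      also have "\<dots> \<le> w m * (\<epsilon> * B)"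
        using N[OF that, of m] B e
        by (intro mult_left_mono mult_mono w_nonneg) (auto simp: dist_real_def)
      finally show ?thesis .
    qed
    have s: "summable (\<lambda>m. w m * (\<epsilon> * B))" by (intro summable_mult2 w_summable)
    have "norm (ip (T k) h - ip f h) \<le> (\<Sum>m. w m * (\<epsilon> * B))"
      unfolding sums_unique[OF d] using norm_suminf_le[OF b s] .
    also have "\<dots> = \<epsilon> * (suminf w * B)" by (simp add: suminf_mult2[OF w_summable, symmetric])
    also have "\<dots> < \<epsilon> * (suminf w * B + 1)" using e by simp
    also have "\<dots> = r"
      using add_nonneg_pos[OF mult_nonneg_nonneg[OF W B(1)] zero_less_one] by (simp add: \<epsilon>_def)
    finally show ?thesis .
  qed
  then show "\<exists>no. \<forall>n\<ge>no. norm (ip (T n) h - ip f h) < r" by blast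
qed

text \<open>Point evaluation is an inner product, so the Fourier coefficients of a point mass are
  weighted values of the orthonormal polynomials.\<close>

lemma ip_indicator: "ip (\<lambda>m. if m = k then 1 else 0) h = w k * h k"
proof -
  have "(\<lambda>m. if m = k then w k * h k else 0) sums (w k * h k)"
    using sums_single[of k "\<lambda>m. w m * h m"] by (simp cong: if_cong)
  moreover have "(\<lambda>m. w m * ((if m = k then 1 else 0) * h m)) = (\<lambda>m. if m = k then w k * h k else 0)"
    by auto
  ultimately show ?thesis unfolding ip_def by (simp add: sums_iff)
qed

lemma approx_sub_sum:
  assumes "poly_approximable x f"
  shows "poly_approximable x (\<lambda>m. f m - (\<Sum>n<N. c n * e n m))"
  using poly_approximable_add[OF assms poly_approximable_poly[of x "- (\<Sum>n<N. smult (c n) (E n))"]]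
  by (simp add: poly_sum)

lemma ip_sub_sum_left:
  assumes "poly_approximable x f" "poly_approximable x h"
  shows "ip (\<lambda>m. f m - (\<Sum>n<N. c n * e n m)) h = ip f h - (\<Sum>n<N. c n * ip (e n) h)"
proof (induction N)
  case (Suc N)
  have "ip (\<lambda>m. f m - (\<Sum>n<Suc N. c n * e n m)) h =
        ip (\<lambda>m. (f m - (\<Sum>n<N. c n * e n m)) + (- c N) * e N m) h"
    by (simp add: algebra_simps)
  also have "\<dots> = ip (\<lambda>m. f m - (\<Sum>n<N. c n * e n m)) h + ip (\<lambda>m. (- c N) * e N m) h"
    by (intro ip_add approx_sub_sum assms poly_approximable_cmult poly_approximable_poly)
  also have "ip (\<lambda>m. (- c N) * e N m) h = - c N * ip (e N) h"
    by (intro ip_cmult assms poly_approximable_poly)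
  finally show ?case using Suc by simp
qed simp

text \<open>Completing the square in the coefficients \<open>c\<close>: among all combinations of
  the first \<open>N\<close> polynomials, the Fourier coefficients give the smallest error.\<close>

lemma ip_sub_sum:
  assumes f: "poly_approximable x f"
  shows "ip (\<lambda>m. f m - (\<Sum>n<N. c n * e n m)) (\<lambda>m. f m - (\<Sum>n<N. c n * e n m)) =
         ip f f - (\<Sum>n<N. (ip f (e n))\<^sup>2) + (\<Sum>n<N. (ip f (e n) - c n)\<^sup>2)"
proof -
  let ?h = "\<lambda>m. f m - (\<Sum>n<N. c n * e n m)"
  have e: "poly_approximable x (e n)" for n by (rule poly_approximable_poly)
  have h: "poly_approximable x ?h" by (rule approx_sub_sum[OF f])
  have eh: "ip (e k) ?h = ip f (e k) - c k" if "k < N" for k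
  proof -
    have "ip (e k) ?h = ip f (e k) - (\<Sum>n<N. c n * ip (e n) (e k))"
      using ip_sub_sum_left[OF f e] by (simp add: ip_commute)
    also have "(\<Sum>n<N. c n * ip (e n) (e k)) = (\<Sum>n<N. if n = k then c n else 0)"
      unfolding ip_def orthonormal by (intro sum.cong) auto
    also have "\<dots> = c k" using that by simp
    finally show ?thesis .
  qed
  have "ip ?h ?h = ip f ?h - (\<Sum>n<N. c n * ip (e n) ?h)"
    by (rule ip_sub_sum_left[OF f h])
  also have "ip f ?h = ip f f - (\<Sum>n<N. c n * ip f (e n))"
    using ip_sub_sum_left[OF f f] by (simp add: ip_commute)
  also have "(\<Sum>n<N. c n * ip (e n) ?h) = (\<Sum>n<N. c n * (ip f (e n) - c n))"
    using eh by (intro sum.cong) auto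
  finally show ?thesis
    by (simp add: power2_eq_square algebra_simps sum.distrib sum_subtractf sum_distrib_left)
qed

text \<open>Once \<open>N\<close> exceeds the degree of a uniform approximant \<open>P\<close>, the
  expansion of \<open>P\<close> competes with the Fourier sum. By \<open>ip_sub_sum\<close> the
  Fourier sum has no larger error, and Bessel's inequality bounds the partial sums from the other
  side.\<close>

lemma parseval:
  assumes f: "poly_approximable x f"
  shows "(\<lambda>n. (ip f (e n))\<^sup>2) sums ip f f"
  unfolding sums_def
proof (rule LIMSEQ_I)
  fix r :: real assume r: "r > 0"
  \<comment> \<open>Chosen so that the bound \<open>suminf w * \<epsilon>\<^sup>2\<close> of
    \<open>ip_le\<close> lies below \<open>r\<close>.\<close>
  define \<epsilon> where "\<epsilon> = sqrt (r / (2 * (suminf w + 1)))"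
  have W: "suminf w \<ge> 0" using w_nonneg w_summable by (intro suminf_nonneg) auto
  have e2: "\<epsilon>\<^sup>2 = r / (2 * (suminf w + 1))" and e0: "\<epsilon> > 0" using r W by (auto simp: \<epsilon>_def)
  obtain P where P: "\<forall>m. \<bar>f m - poly P (x m)\<bar> \<le> \<epsilon>"
    using f e0 unfolding poly_approximable_def by blast
  have "norm ((\<Sum>n<N. (ip f (e n))\<^sup>2) - ip f f) < r" if N: "N \<ge> Suc (degree P)" for N
  proof -
    obtain c where c: "P = (\<Sum>n<N. smult (c n) (E n))"
      using poly_span_degree[of E P N] degree_E coeff_E N by auto
    have "ip f f - (\<Sum>n<N. (ip f (e n))\<^sup>2) + (\<Sum>n<N. (ip f (e n) - c n)\<^sup>2) \<le> suminf w * \<epsilon>\<^sup>2"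
      unfolding ip_sub_sum[OF f, symmetric]
      using P by (intro ip_le approx_sub_sum f) (simp add: c poly_sum)
    moreover have "(\<Sum>n<N. (ip f (e n) - c n)\<^sup>2) \<ge> 0" by (intro sum_nonneg) simp
    moreover have "suminf w * \<epsilon>\<^sup>2 < r"
    proof -
      have "suminf w * r < r * (2 * (suminf w + 1))" using r W
        by (simp add: algebra_simps add_nonneg_pos)
      then show ?thesis unfolding e2 using W by (simp add: field_simps)
    qed
    \<comment> \<open>Bessel's inequality: with \<open>c n = ip f (e n)\<close> the last sum in
      \<open>ip_sub_sum\<close> vanishes.\<close>
    moreover have "0 \<le> ip f f - (\<Sum>n<N. (ip f (e n))\<^sup>2)"
      using ip_nonneg[OF approx_sub_sum[OF f], of "\<lambda>n. ip f (e n)" N]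
      unfolding ip_sub_sum[OF f] by simp
    ultimately show ?thesis by (simp add: abs_less_iff)
  qed
  then show "\<exists>no. \<forall>n\<ge>no. norm ((\<Sum>n<n. (ip f (e n))\<^sup>2) - ip f f) < r" by blast
qed

text \<open>Polarization: Parseval's identity for \<open>f + g\<close>, \<open>f\<close> and
  \<open>g\<close>.\<close>

lemma parseval_bilinear:
  assumes f: "poly_approximable x f" and g: "poly_approximable x g"
  shows "(\<lambda>n. ip f (e n) * ip g (e n)) sums ip f g"
proof -
  have e: "poly_approximable x (e n)" for n by (rule poly_approximable_poly)
  have fg: "poly_approximable x (\<lambda>m. f m + g m)" by (intro poly_approximable_add f g)
  have "(\<lambda>n. ((ip (\<lambda>m. f m + g m) (e n))\<^sup>2 - (ip f (e n))\<^sup>2 - (ip g (e n))\<^sup>2) / 2) sums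
        ((ip (\<lambda>m. f m + g m) (\<lambda>m. f m + g m) - ip f f - ip g g) / 2)"
    by (intro sums_divide sums_diff parseval f g fg)
  moreover have "ip (\<lambda>m. f m + g m) (\<lambda>m. f m + g m) = ip f f + 2 * ip f g + ip g g"
    using ip_add[OF f g fg] ip_add[OF f g f] ip_add[OF f g g]
    by (simp add: ip_commute)
  moreover have "ip (\<lambda>m. f m + g m) (e n) = ip f (e n) + ip g (e n)" for n
    by (rule ip_add[OF f g e])
  ultimately show ?thesis
    by (simp add: power2_eq_square algebra_simps)
qed

end

section \<open>The q-Bessel function\<close>

text \<open>The normalized $q$-Bessel function as a power series in \<open>t = x\<^sup>2\<close>, with
  \<open>a = q powr (2 * \<nu> + 2)\<close>; raising \<open>\<nu>\<close> by \<open>1\<close> replaces \<open>a\<close> by \<open>a * q\<^sup>2\<close>.\<close>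

definition qbessel_coeff :: "real \<Rightarrow> real \<Rightarrow> nat \<Rightarrow> real" where
  "qbessel_coeff a q n = (-1) ^ n * (q ^ (n * (n + 1)) / (qpoch a (q\<^sup>2) n * qpoch (q\<^sup>2) (q\<^sup>2) n))"

definition qbessel_series :: "real \<Rightarrow> real \<Rightarrow> real \<Rightarrow> real" where
  "qbessel_series a q t = (\<Sum>n. qbessel_coeff a q n * t ^ n)"

lemma norm_qbessel_eq: "norm_qbessel q \<nu> x = qbessel_series (q powr (2 * \<nu> + 2)) q (x\<^sup>2)"
  by (simp add: norm_qbessel_def qbessel_series_def qbessel_coeff_def mult_ac flip: power_mult)

locale qbessel_params =
  fixes a q p :: real
  assumes q: "0 < q" "q < 1" and a: "0 < a" "a < 1" and p_def: "p = q\<^sup>2"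
begin

lemma p: "0 < p" "p < 1"
  using q by (auto simp: p_def power_less_one_iff)

lemma ap: "0 < a * p" "a * p < 1"
  using a p mult_strict_mono[of a 1 p 1] by auto

lemma qpoch_a_pos: "qpoch a p n > 0" and qpoch_p_pos: "qpoch p p n > 0"
  and qpoch_ap_pos: "qpoch (a * p) p n > 0"
  using a p ap by (auto intro: qpoch_pos)

lemma one_minus_pos: "1 - a * p ^ n > 0" "1 - p * p ^ n > 0"
  using qpoch_a_pos[of "Suc n"] qpoch_a_pos[of n] qpoch_p_pos[of "Suc n"] qpoch_p_pos[of n]
  by (auto simp: qpoch_Suc zero_less_mult_iff)

lemma q_power_Suc: "q ^ (Suc n * (Suc n + 1)) = q ^ (n * (n + 1)) * (p * p ^ n)"
proof -
  have "Suc n * (Suc n + 1) = n * (n + 1) + 2 * Suc n" by (simp add: algebra_simps)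
  then show ?thesis unfolding p_def by (simp only: power_add power_mult) simp
qed

lemma qbessel_coeff_Suc:
  "qbessel_coeff a q (Suc n) = qbessel_coeff a q n * (- (p * p ^ n) / ((1 - a * p ^ n) * (1 - p * p ^ n)))"
  unfolding qbessel_coeff_def q_power_Suc p_def[symmetric] qpoch_Suc
  by (simp add: field_simps)

text \<open>Consecutive terms have a ratio of order \<open>p ^ n\<close>, so the series converges
  for every \<open>t\<close>.\<close>

lemma summable_qbessel: "summable (\<lambda>n. qbessel_coeff a q n * t ^ n)"
proof -
  have "(\<lambda>n. p * p ^ n * \<bar>t\<bar> / ((1 - a) * (1 - p))) \<longlonglongrightarrow> p * 0 * \<bar>t\<bar> / ((1 - a) * (1 - p))"
    using p a by (intro tendsto_intros LIMSEQ_realpow_zero) auto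
  then have "eventually (\<lambda>n. p * p ^ n * \<bar>t\<bar> / ((1 - a) * (1 - p)) < 1 / 2) sequentially"
    by (rule order_tendstoD) simp
  then obtain N where N: "\<And>n. n \<ge> N \<Longrightarrow> p * p ^ n * \<bar>t\<bar> / ((1 - a) * (1 - p)) < 1 / 2"
    unfolding eventually_sequentially by blast
  show ?thesis
  proof (rule summable_ratio_test[of "1 / 2" N])
    fix n assume "n \<ge> N"
    have "a * p ^ n \<le> a * 1" "p * p ^ n \<le> p * 1"
      using a p by (intro mult_left_mono power_le_one; simp)+
    \<comment> \<open>The denominator of the ratio is smallest at index 0, which leaves a bound
      depending on \<open>n\<close> through \<open>p ^ n\<close> alone.\<close>
    then have "(1 - a) * (1 - p) \<le> (1 - a * p ^ n) * (1 - p * p ^ n)"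
      using a p one_minus_pos[of n] by (intro mult_mono) auto
    then have "p * p ^ n * \<bar>t\<bar> / ((1 - a * p ^ n) * (1 - p * p ^ n)) \<le> p * p ^ n * \<bar>t\<bar> / ((1 - a) * (1 - p))"
      using a p one_minus_pos[of n] by (intro divide_left_mono) auto
    with N[OF \<open>n \<ge> N\<close>] have le: "p * p ^ n * \<bar>t\<bar> / ((1 - a * p ^ n) * (1 - p * p ^ n)) \<le> 1 / 2"
      by linarith
    have "norm (qbessel_coeff a q (Suc n) * t ^ Suc n) =
       (p * p ^ n * \<bar>t\<bar> / ((1 - a * p ^ n) * (1 - p * p ^ n))) * norm (qbessel_coeff a q n * t ^ n)"
      unfolding qbessel_coeff_Suc
      using abs_of_pos[OF one_minus_pos(1)[of n]] abs_of_pos[OF one_minus_pos(2)[of n]] p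
      by (simp add: abs_mult power_abs)
    also have "\<dots> \<le> 1 / 2 * norm (qbessel_coeff a q n * t ^ n)"
      using le by (intro mult_right_mono) auto
    finally show "norm (qbessel_coeff a q (Suc n) * t ^ Suc n) \<le> 1 / 2 * norm (qbessel_coeff a q n * t ^ n)" .
  qed simp
qed

abbreviation f where "f \<equiv> qbessel_series a q"
lemma sums_f: "(\<lambda>n. qbessel_coeff a q n * t ^ n) sums f t"
  unfolding qbessel_series_def by (rule summable_sums[OF summable_qbessel])

lemma has_deriv_f: "(f has_field_derivative deriv f t) (at t)"
proof -
  have "(f has_field_derivative (\<Sum>n. diffs (qbessel_coeff a q) n * t ^ n)) (at t)"
    using termdiffs_strong_converges_everywhere[OF summable_qbessel]
    by (simp add: qbessel_series_def[abs_def])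
  then show ?thesis by (simp add: DERIV_imp_deriv)
qed

lemma has_deriv_f_scaled: "((\<lambda>t. f (p * t)) has_field_derivative p * deriv f (p * t)) (at t)"
  by (rule DERIV_cong[OF DERIV_chain2[OF has_deriv_f]]) (auto intro!: derivative_eq_intros)

lemma isCont_f: "isCont f t"
  using has_deriv_f DERIV_isCont by blast

text \<open>Termwise differentiation gives another power series that converges everywhere.
  Continuity at 0 enters the limit in \<open>qbessel_square_sums\<close>.\<close>

lemma isCont_deriv_f: "isCont (deriv f) t"
proof -
  have "deriv f = (\<lambda>t. \<Sum>n. diffs (qbessel_coeff a q) n * t ^ n)"
    using termdiffs_strong_converges_everywhere[OF summable_qbessel]
    by (auto simp: qbessel_series_def[abs_def] intro!: DERIV_imp_deriv)
  moreover have "summable (\<lambda>n. diffs (qbessel_coeff a q) n * y ^ n)" for y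
    using termdiff_converges_all[OF summable_qbessel] .
  ultimately show ?thesis
    using termdiffs_strong_converges_everywhere[of "diffs (qbessel_coeff a q)" t] DERIV_isCont
    by auto
qed

end

section \<open>Contiguous relations between the parameters \<open>a\<close> and
  \<open>a * p\<close>, and the sum of squares\<close>

locale qbessel_contiguous = qbessel_params
begin

abbreviation g where "g \<equiv> qbessel_series (a * p) q"

sublocale shifted: qbessel_params "a * p" q p
  by unfold_locales (use q ap p_def in auto)

text \<open>Termwise: the difference produces the factor \<open>1 - p ^ n\<close>, which cancels the
  last factor of \<open>qpoch p p n\<close>, while splitting the first factor off
  \<open>qpoch a p n\<close> shifts the parameter to \<open>a * p\<close>. The constant term drops
  out, hence the index shift.\<close>

lemma f_diff: "f t - f (p * t) = - (p * t / (1 - a)) * g (p * t)"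
proof -
  have "(\<lambda>n. qbessel_coeff a q n * t ^ n - qbessel_coeff a q n * (p * t) ^ n) sums (f t - f (p * t))"
    by (intro sums_diff sums_f)
  then have "(\<lambda>n. qbessel_coeff a q (Suc n) * t ^ Suc n - qbessel_coeff a q (Suc n) * (p * t) ^ Suc n)
               sums (f t - f (p * t))"
    by (subst sums_Suc_iff) simp
  moreover have "qbessel_coeff a q (Suc n) * t ^ Suc n - qbessel_coeff a q (Suc n) * (p * t) ^ Suc n =
     - (p * t / (1 - a)) * (qbessel_coeff (a * p) q n * (p * t) ^ n)" for n
  proof -
    have "qbessel_coeff a q (Suc n) * (1 - p * p ^ n) = - (p / (1 - a)) * (qbessel_coeff (a * p) q n * p ^ n)"
    proof -
      have alg: "(- s) * (Q * (p * u) / (c * A * (P * w))) * w = - (p / c) * (s * (Q / (A * P)) * u)"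
        if "w \<noteq> 0" for s Q u c A P w :: real
        using that by simp
      show ?thesis
        unfolding qbessel_coeff_def q_power_Suc p_def[symmetric] qpoch_Suc_shift[of a] qpoch_Suc[of p p]
        using one_minus_pos[of n] by (subst alg[symmetric, where w = "1 - p * p ^ n"]) auto
    qed
    then have "qbessel_coeff a q (Suc n) * (1 - p * p ^ n) * t ^ Suc n =
        - (p / (1 - a)) * (qbessel_coeff (a * p) q n * p ^ n) * t ^ Suc n" by simp
    then show ?thesis by (simp add: power_mult_distrib algebra_simps)
  qed
  ultimately have "(\<lambda>n. - (p * t / (1 - a)) * (qbessel_coeff (a * p) q n * (p * t) ^ n)) sums (f t - f (p * t))"
    by simp
  then show ?thesis using sums_unique2 sums_mult[OF shifted.sums_f] by blast
qed

text \<open>Termwise: the factor \<open>1 - a * p ^ n\<close> produced on the left converts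
  \<open>qpoch (a * p) p n\<close> back to \<open>qpoch a p n\<close>.\<close>

lemma g_diff: "g t - a * g (p * t) = (1 - a) * f t"
proof -
  have "(\<lambda>n. qbessel_coeff (a * p) q n * t ^ n - a * (qbessel_coeff (a * p) q n * (p * t) ^ n)) sums (g t - a * g (p * t))"
    by (intro sums_diff sums_mult shifted.sums_f)
  moreover have "qbessel_coeff (a * p) q n * t ^ n - a * (qbessel_coeff (a * p) q n * (p * t) ^ n) =
     (1 - a) * (qbessel_coeff a q n * t ^ n)" for n
  proof -
    have "(1 - a) * qpoch (a * p) p n = qpoch a p n * (1 - a * p ^ n)"
      by (metis qpoch_Suc qpoch_Suc_shift)
    then have "qbessel_coeff (a * p) q n * (1 - a * p ^ n) = (1 - a) * qbessel_coeff a q n"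
    proof -
      have alg: "s * (Q / (A * P)) * d = c * (s * (Q / (B * P)))"
        if "c * A = B * d" "A \<noteq> 0" "B \<noteq> 0" "P \<noteq> 0" for s Q A P B c d :: real
        using that by (simp add: field_simps)
      show ?thesis
        unfolding qbessel_coeff_def p_def[symmetric]
        using qpoch_p_pos[of n] qpoch_ap_pos[of n] qpoch_a_pos[of n]
        by (intro alg[OF \<open>(1 - a) * qpoch (a * p) p n = qpoch a p n * (1 - a * p ^ n)\<close>]) auto
    qed
    then have "qbessel_coeff (a * p) q n * (1 - a * p ^ n) * t ^ n = (1 - a) * qbessel_coeff a q n * t ^ n" by simp
    then show ?thesis by (simp add: power_mult_distrib algebra_simps)
  qed
  ultimately have "(\<lambda>n. (1 - a) * (qbessel_coeff a q n * t ^ n)) sums (g t - a * g (p * t))"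
    by simp
  then show ?thesis using sums_unique2 sums_mult[OF sums_f] by blast
qed

lemma f_diff_deriv:
  "deriv f t - p * deriv f (p * t) = - (p / (1 - a)) * (g (p * t) + p * t * deriv g (p * t))"
proof -
  have "((\<lambda>t. f t - f (p * t)) has_field_derivative deriv f t - p * deriv f (p * t)) (at t)"
    by (intro derivative_intros has_deriv_f has_deriv_f_scaled)
  moreover have "((\<lambda>t. - (p / (1 - a)) * (t * g (p * t))) has_field_derivative
      - (p / (1 - a)) * (1 * g (p * t) + p * deriv g (p * t) * t)) (at t)"
    by (intro DERIV_cmult DERIV_mult DERIV_ident shifted.has_deriv_f_scaled)
  then have "((\<lambda>t. - (p * t / (1 - a)) * g (p * t)) has_field_derivative
      - (p / (1 - a)) * (g (p * t) + p * t * deriv g (p * t))) (at t)"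
    by (simp add: mult_ac)
  ultimately show ?thesis unfolding f_diff by (rule DERIV_unique)
qed

lemma g_diff_deriv: "deriv g t - a * (p * deriv g (p * t)) = (1 - a) * deriv f t"
proof -
  have "((\<lambda>t. g t - a * g (p * t)) has_field_derivative deriv g t - a * (p * deriv g (p * t))) (at t)"
    by (intro derivative_intros shifted.has_deriv_f DERIV_cmult shifted.has_deriv_f_scaled)
  moreover have "((\<lambda>t. (1 - a) * f t) has_field_derivative (1 - a) * deriv f t) (at t)"
    by (intro DERIV_cmult has_deriv_f)
  ultimately show ?thesis unfolding g_diff by (rule DERIV_unique)
qed

text \<open>The derivative at \<open>s = t\<close> of the Casoratian \<open>t g(t) f(s) - s g(s) f(t)\<close> of two
  solutions of the \<open>q\<close>-difference equation.\<close>

definition casoratian_deriv :: "real \<Rightarrow> real" where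
  "casoratian_deriv t = t * g t * deriv f t - g t * f t - t * deriv g t * f t"

text \<open>The contiguous relations and their derivatives express everything at
  \<open>p * t\<close> through values at \<open>t\<close>.\<close>

lemma casoratian_deriv_diff:
  "casoratian_deriv t - a * casoratian_deriv (p * t) = - (1 - a) * (f t)\<^sup>2"
proof -
  define k where "k = 1 / (1 - a)"
  have f1: "f (p * t) = f t + k * p * t * g (p * t)"
    using f_diff[of t] by (simp add: k_def)
  have f2: "p * deriv f (p * t) = deriv f t + k * p * (g (p * t) + p * t * deriv g (p * t))"
    using f_diff_deriv[of t] by (simp add: k_def algebra_simps)
  have g1: "a * g (p * t) = g t - (1 - a) * f t"
    using g_diff[of t] by simp
  have g2: "a * (p * deriv g (p * t)) = deriv g t - (1 - a) * deriv f t"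
    using g_diff_deriv[of t] by simp
  have "casoratian_deriv (p * t) = t * g (p * t) * (p * deriv f (p * t)) - g (p * t) * f (p * t)
      - t * (p * deriv g (p * t)) * f (p * t)"
    by (simp add: casoratian_deriv_def)
  \<comment> \<open>All terms containing \<open>k\<close> cancel; this is the antisymmetry of the
    Casoratian.\<close>
  also have "\<dots> = t * g (p * t) * deriv f t - g (p * t) * f t - t * (p * deriv g (p * t)) * f t"
    unfolding f1 f2 by (simp add: algebra_simps)
  finally have "a * casoratian_deriv (p * t) =
      a * (t * g (p * t) * deriv f t - g (p * t) * f t - t * (p * deriv g (p * t)) * f t)"
    by (rule arg_cong)
  also have "\<dots> =
      t * (a * g (p * t)) * deriv f t - (a * g (p * t)) * f t - t * (a * (p * deriv g (p * t))) * f t"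
    by (simp add: algebra_simps)
  finally have "a * casoratian_deriv (p * t) =
      t * (a * g (p * t)) * deriv f t - (a * g (p * t)) * f t - t * (a * (p * deriv g (p * t))) * f t" .
  then show ?thesis unfolding g1 g2
    by (simp add: casoratian_deriv_def algebra_simps power2_eq_square)
qed

text \<open>The same cancellation one step up the grid. The closed form evaluates the function of
  order \<nu> at \<open>l / q\<close>, whose square is \<open>t / p\<close> for
  \<open>t = l\<^sup>2\<close>.\<close>

lemma casoratian_deriv_eq:
  "casoratian_deriv t = t * g t * (deriv f (t / p) / p) - g t * f (t / p) - t * deriv g t * f (t / p)"
proof -
  define k where "k = 1 / (1 - a)"
  have f1: "f (t / p) = f t - k * t * g t"
    using f_diff[of "t / p"] p by (simp add: k_def)
  have f2: "deriv f (t / p) / p = deriv f t - k * (g t + t * deriv g t)"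
    using f_diff_deriv[of "t / p"] p by (simp add: k_def field_simps)
  show ?thesis unfolding f1 f2 casoratian_deriv_def by (simp add: algebra_simps)
qed

text \<open>By \<open>casoratian_deriv_diff\<close> each summand is a difference of consecutive
  values of \<open>a ^ m * casoratian_deriv (p ^ m * t)\<close>, up to the constant
  \<open>- 1 / (1 - a)\<close>. These values tend to 0 because \<open>a < 1\<close> and the
  Casoratian derivative is continuous at 0.\<close>

lemma qbessel_square_sums:
  "(\<lambda>m. a ^ m * (f (p ^ m * t))\<^sup>2) sums (- casoratian_deriv t / (1 - a))"
proof -
  define u where "u m = a ^ m * casoratian_deriv (p ^ m * t)" for m
  have "isCont casoratian_deriv 0"
    unfolding casoratian_deriv_def[abs_def]
    by (intro continuous_intros isCont_f isCont_deriv_f shifted.isCont_f shifted.isCont_deriv_f)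
  moreover have "(\<lambda>m. p ^ m * t) \<longlonglongrightarrow> 0 * t"
    using p by (intro tendsto_intros LIMSEQ_realpow_zero) auto
  ultimately have "(\<lambda>m. casoratian_deriv (p ^ m * t)) \<longlonglongrightarrow> casoratian_deriv 0"
    using isCont_tendsto_compose[of 0 casoratian_deriv "\<lambda>m. p ^ m * t" sequentially] by simp
  then have "u \<longlonglongrightarrow> 0 * casoratian_deriv 0"
    unfolding u_def using a by (intro tendsto_mult LIMSEQ_realpow_zero) auto
  then have "u \<longlonglongrightarrow> 0" by simp
  then have "(\<lambda>m. u m - u (Suc m)) sums (u 0 - 0)" by (rule telescope_sums')
  then have "(\<lambda>m. - (u m - u (Suc m)) / (1 - a)) sums (- (u 0 - 0) / (1 - a))"
    by (intro sums_divide sums_minus)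
  moreover have "- (u m - u (Suc m)) / (1 - a) = a ^ m * (f (p ^ m * t))\<^sup>2" for m
  proof -
    have "u m - u (Suc m) = a ^ m * (casoratian_deriv (p ^ m * t) - a * casoratian_deriv (p * (p ^ m * t)))"
      by (simp add: u_def algebra_simps)
    also note casoratian_deriv_diff
    finally have "u m - u (Suc m) = a ^ m * (- (1 - a) * (f (p ^ m * t))\<^sup>2)" .
    then show ?thesis using a by (simp add: field_simps)
  qed
  ultimately show ?thesis by (simp add: u_def)
qed

end

section \<open>Little q-Jacobi polynomials\<close>

text \<open>The little q-Jacobi polynomial p_n(y; a/p, 1; p) in the variable y; the factor
  \<open>p ^ j\<close> stems from the argument p y of the hypergeometric series.\<close>

definition lqj_poly :: "real \<Rightarrow> real \<Rightarrow> nat \<Rightarrow> real poly" where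
  "lqj_poly a p n = (\<Sum>j\<le>n. monom (qpoch (a * p ^ n) p j * qpoch (p powi (- int n)) p j * p ^ j /
                                     (qpoch a p j * qpoch p p j)) j)"

lemma poly_lqj_poly:
  "poly (lqj_poly a p n) y = (\<Sum>j\<le>n. qpoch (a * p ^ n) p j * qpoch (p powi (- int n)) p j * p ^ j /
                                     (qpoch a p j * qpoch p p j) * y ^ j)"
  by (simp add: lqj_poly_def poly_sum poly_monom)

lemma degree_lqj_poly: "degree (lqj_poly a p n) \<le> n"
  unfolding lqj_poly_def
  by (intro degree_sum_le) (auto intro: order.trans[OF degree_monom_le])

lemma coeff_lqj_poly: "coeff (lqj_poly a p n) n =
    qpoch (a * p ^ n) p n * qpoch (p powi (- int n)) p n * p ^ n / (qpoch a p n * qpoch p p n)"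
  by (simp add: lqj_poly_def coeff_sum coeff_monom)

lemma little_q_jacobi_eq_poly:
  assumes "0 < q" "a = b * q"
  shows "little_q_jacobi n y b 1 q = poly (lqj_poly a q n) y"
proof -
  have "little_q_jacobi n y b 1 q =
     (\<Sum>k. qpoch (a * q ^ n) q k * qpoch (q powi (- int n)) q k / (qpoch a q k * qpoch q q k) * (q * y) ^ k)"
    unfolding little_q_jacobi_def phi21_def using assms(2) by (simp add: mult_ac)
  also have "\<dots> = (\<Sum>k\<le>n. qpoch (a * q ^ n) q k * qpoch (q powi (- int n)) q k / (qpoch a q k * qpoch q q k) * (q * y) ^ k)"
    using assms(1) by (intro suminf_finite) (auto simp: qpoch_inverse_power_eq_0)
  also have "\<dots> = poly (lqj_poly a q n) y"
    unfolding poly_lqj_poly by (simp add: power_mult_distrib mult_ac)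
  finally show ?thesis .
qed

section \<open>Moments and orthonormality on the grid\<close>

context qbessel_params
begin

text \<open>The right-hand side of \<open>qpoch_partial_fractions\<close> at
  \<open>z = a * p ^ k\<close>.\<close>

definition lqj_moment :: "nat \<Rightarrow> nat \<Rightarrow> real" where
  "lqj_moment n k = qpoch p p n / qpoch a p n * (\<Prod>i<n. a * p ^ k - a * p ^ i) / qpoch (a * p ^ k) p (Suc n)"

text \<open>Each monomial of the polynomial contributes a geometric series in \<open>m\<close> with
  ratio \<open>a * p ^ k * p ^ j\<close>. Summing the resulting fractions over \<open>j\<close> is
  the partial fraction decomposition read backwards.\<close>

lemma lqj_moment_sums:
  "(\<lambda>m. a ^ m * ((p ^ m) ^ k * poly (lqj_poly a p n) (p ^ m))) sums lqj_moment n k"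
proof -
  have ak: "a * p ^ k < 1" using one_minus_pos[of k] by simp
  define r where "r j = qpoch (a * p ^ n) p j * qpoch (p powi (- int n)) p j * p ^ j /
                                     (qpoch a p j * qpoch p p j)" for j
  have "(\<lambda>m. \<Sum>j\<le>n. r j * (a * p ^ k * p ^ j) ^ m) sums (\<Sum>j\<le>n. r j * (1 / (1 - a * p ^ k * p ^ j)))"
  proof (intro sums_sum sums_mult geometric_sums)
    fix j
    show "norm (a * p ^ k * p ^ j) < 1"
      using one_minus_pos(1)[of "k + j"] a p by (simp add: power_add mult_ac abs_mult)
  qed
  moreover have "(\<Sum>j\<le>n. r j * (1 / (1 - a * p ^ k * p ^ j))) = lqj_moment n k"
    using qpoch_partial_fractions[OF p a(2) ak, of n] by (simp add: r_def lqj_moment_def)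
  moreover have "(\<Sum>j\<le>n. r j * (a * p ^ k * p ^ j) ^ m) = a ^ m * ((p ^ m) ^ k * poly (lqj_poly a p n) (p ^ m))" for m
    unfolding poly_lqj_poly sum_distrib_left r_def
    by (intro sum.cong) (simp_all add: power_mult_distrib mult_ac add_mult_distrib add_mult_distrib2 flip: power_mult power_add)
  ultimately show ?thesis by simp
qed

text \<open>The factor with \<open>i = k\<close> vanishes; this is orthogonality to all lower
  powers.\<close>

lemma lqj_moment_eq_0: "k < n \<Longrightarrow> lqj_moment n k = 0"
  unfolding lqj_moment_def by (auto intro!: bexI[of _ k])

text \<open>Pulling \<open>- (p ^ i)\<close> out of each factor leaves 1 - p^(k-i). The exponents
  add up to n(n-1)/2 in \<open>p\<close>, that is n(n-1) in \<open>q\<close>.\<close>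

lemma prod_power_diff:
  "n \<le> k \<Longrightarrow> (\<Prod>i<n. p ^ k - p ^ i) * qpoch p p (k - n) = (-1) ^ n * q ^ (n * (n - 1)) * qpoch p p k"
proof (induction n)
  case (Suc n)
  have e1: "k - n = Suc (k - Suc n)" using Suc.prems by simp
  have e2: "qpoch p p (k - n) = qpoch p p (k - Suc n) * (1 - p * p ^ (k - Suc n))"
    unfolding e1 by (simp add: qpoch_Suc)
  have e3: "p ^ k = p ^ n * (p * p ^ (k - Suc n))"
    using Suc.prems by (simp flip: power_Suc power_add)
  have e4: "q ^ (Suc n * (Suc n - 1)) = p ^ n * q ^ (n * (n - 1))"
  proof -
    have "Suc n * (Suc n - 1) = 2 * n + n * (n - 1)" by (cases n) simp_all
    then show ?thesis unfolding p_def by (simp only: power_add power_mult)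
  qed
  have "(\<Prod>i<Suc n. p ^ k - p ^ i) * qpoch p p (k - Suc n) =
     - (p ^ n) * ((\<Prod>i<n. p ^ k - p ^ i) * (qpoch p p (k - Suc n) * (1 - p * p ^ (k - Suc n))))"
    by (simp add: e3 algebra_simps)
  also have "\<dots> = - (p ^ n) * ((-1) ^ n * q ^ (n * (n - 1)) * qpoch p p k)"
    using Suc unfolding e2 by simp
  also have "\<dots> = (-1) ^ Suc n * q ^ (Suc n * (Suc n - 1)) * qpoch p p k"
    unfolding e4 by simp
  finally show ?case .
qed simp

lemma lqj_moment_eq:
  "lqj_moment n (n + i) = (-1) ^ n * a ^ n * q ^ (n * (n - 1)) * qpoch p p n * qpoch p p (n + i) /
     (qpoch a p n * qpoch p p i * qpoch (a * p ^ (n + i)) p (Suc n))"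
proof -
  have "(\<Prod>j<n. a * p ^ (n + i) - a * p ^ j) = a ^ n * (\<Prod>j<n. p ^ (n + i) - p ^ j)"
    by (simp add: right_diff_distrib[symmetric] prod.distrib)
  also have "(\<Prod>j<n. p ^ (n + i) - p ^ j) = (-1) ^ n * q ^ (n * (n - 1)) * qpoch p p (n + i) / qpoch p p i"
    using prod_power_diff[of n "n + i"] qpoch_p_pos[of i] by (simp add: field_simps)
  finally show ?thesis unfolding lqj_moment_def by simp
qed

text \<open>The power of \<open>q\<close> on the left is the one that \<open>lqj_moment_eq\<close>
  supplies, so it disappears from the product in \<open>lqj_norm\<close>.\<close>

lemma coeff_lqj_poly_eq:
  "coeff (lqj_poly a p n) n * q ^ (n * (n - 1)) = (-1) ^ n * qpoch (a * p ^ n) p n / qpoch a p n"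
proof -
  have "qpoch (p powi (- int n)) p n * (\<Prod>i<n. p ^ n) = (\<Prod>i<n. p ^ n - p ^ i)"
    unfolding qpoch_def prod.distrib[symmetric]
    using p by (intro prod.cong) (simp_all add: power_int_minus field_simps)
  also have "\<dots> = (-1) ^ n * q ^ (n * (n - 1)) * qpoch p p n"
    using prod_power_diff[of n n] by simp
  also have "(\<Prod>i<n. p ^ n) = q ^ (n * (n - 1)) * (q ^ (n * (n - 1)) * p ^ n)"
  proof -
    have "2 * (n * n) = n * (n - 1) + (n * (n - 1) + 2 * n)" by (cases n) simp_all
    then have "q ^ (2 * (n * n)) = q ^ (n * (n - 1)) * (q ^ (n * (n - 1)) * q ^ (2 * n))"
      by (simp only: power_add)
    then show ?thesis by (simp add: p_def mult.assoc flip: power_mult)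
  qed
  finally have "qpoch (p powi (- int n)) p n * p ^ n * q ^ (n * (n - 1)) = (-1) ^ n * qpoch p p n"
    using q by (simp add: mult_ac)
  then have "qpoch (a * p ^ n) p n * (qpoch (p powi (- int n)) p n * p ^ n * q ^ (n * (n - 1))) / (qpoch a p n * qpoch p p n)
      = qpoch (a * p ^ n) p n * ((-1) ^ n * qpoch p p n) / (qpoch a p n * qpoch p p n)" by simp
  then show ?thesis unfolding coeff_lqj_poly using qpoch_p_pos[of n] by (simp add: mult_ac)
qed

text \<open>By \<open>lqj_poly_ip_sums\<close> with \<open>Q = lqj_poly a p n\<close>, this product
  is the squared norm for the weight \<open>a ^ m\<close>.\<close>

lemma lqj_norm: "coeff (lqj_poly a p n) n * lqj_moment n n =
   a ^ n * (qpoch p p n)\<^sup>2 / ((qpoch a p n)\<^sup>2 * (1 - a * p ^ (2 * n)))"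
proof -
  have pos: "qpoch (a * p ^ n) p k > 0" for k using one_minus_pos[of n] p by (intro qpoch_pos) auto
  have "coeff (lqj_poly a p n) n * lqj_moment n n =
    (coeff (lqj_poly a p n) n * q ^ (n * (n - 1))) * ((-1) ^ n * a ^ n * qpoch p p n * qpoch p p n /
     (qpoch a p n * qpoch (a * p ^ n) p (Suc n)))"
    using lqj_moment_eq[of n 0] by simp
  also have "\<dots> = ((-1) ^ n * (-1) ^ n) * a ^ n * (qpoch p p n)\<^sup>2 / ((qpoch a p n)\<^sup>2 * (1 - a * p ^ n * p ^ n))"
    unfolding coeff_lqj_poly_eq qpoch_Suc using pos[of n] by (simp add: power2_eq_square mult_ac)
  also have "(-1) ^ n * (-1) ^ n = (1 :: real)" by (simp flip: power_mult_distrib)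
  finally show ?thesis by (simp only: mult_2 power_add mult.assoc mult_1_left)
qed

text \<open>The moments below order \<open>n\<close> vanish, so only the coefficient of degree
  \<open>n\<close> contributes.\<close>

lemma lqj_poly_ip_sums:
  assumes "degree Q \<le> n"
  shows "(\<lambda>m. a ^ m * (poly Q (p ^ m) * poly (lqj_poly a p n) (p ^ m))) sums (coeff Q n * lqj_moment n n)"
proof -
  have "(\<lambda>m. \<Sum>k\<le>n. coeff Q k * (a ^ m * ((p ^ m) ^ k * poly (lqj_poly a p n) (p ^ m)))) sums
        (\<Sum>k\<le>n. coeff Q k * lqj_moment n k)"
    by (intro sums_sum sums_mult lqj_moment_sums)
  moreover have "(\<Sum>k\<le>n. coeff Q k * lqj_moment n k) = (\<Sum>k\<le>n. if k = n then coeff Q n * lqj_moment n n else 0)"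
    by (intro sum.cong) (auto simp: lqj_moment_eq_0)
  moreover have "poly Q y = (\<Sum>k\<le>n. coeff Q k * y ^ k)" for y
    unfolding poly_altdef
    using assms by (intro sum.mono_neutral_left) (auto simp: not_le coeff_eq_0)
  ultimately show ?thesis by (simp add: sum_distrib_left sum_distrib_right mult_ac)
qed

text \<open>The normalizing factor, shaped like the prefactor of \<open>P_fun\<close>: there
  \<open>sqrt a\<close> is \<open>q powr (\<nu> + 1)\<close>, and the infinite products reduce to
  \<open>qpoch a p n / qpoch p p n\<close>.\<close>

definition lqj_scale :: "nat \<Rightarrow> real" where
  "lqj_scale n = sqrt ((1 - a * p ^ (2 * n)) / (1 - q)) * (1 / sqrt a ^ n) * (qpoch a p n / qpoch p p n)"

lemma lqj_scale_sq: "(lqj_scale n)\<^sup>2 * (1 - q) * (coeff (lqj_poly a p n) n * lqj_moment n n) = 1"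
proof -
  have "(lqj_scale n)\<^sup>2 = (1 - a * p ^ (2 * n)) / (1 - q) * (1 / a ^ n) * ((qpoch a p n)\<^sup>2 / (qpoch p p n)\<^sup>2)"
  proof -
    have "(sqrt a ^ n)\<^sup>2 = a ^ n"
      using a by (simp add: power2_eq_square flip: power_mult_distrib)
    then show ?thesis
      unfolding lqj_scale_def power_mult_distrib power_divide
      using one_minus_pos(1)[of "2 * n"] q by simp
  qed
  then show ?thesis
    unfolding lqj_norm using one_minus_pos(1)[of "2 * n"] q a qpoch_a_pos[of n] qpoch_p_pos[of n]
    by simp
qed

text \<open>For \<open>a = q powr (2 * \<nu> + 2)\<close> the weight is that of Jackson's q-integral
  over [0,1] against x^(2 \<nu> + 1), taken at x = q^m.\<close>

sublocale discrete_orthonormal_polys "\<lambda>m. (1 - q) * a ^ m" "\<lambda>m. p ^ m" "\<lambda>n. smult (lqj_scale n) (lqj_poly a p n)"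
proof
  fix n k m :: nat
  show "0 \<le> (1 - q) * a ^ m" using q a by simp
  show "summable (\<lambda>m. (1 - q) * a ^ m)" using a by (intro summable_mult summable_geometric) simp
  show "0 \<le> p ^ m" "p ^ m \<le> 1" using p by (auto intro: power_le_one)
  show "degree (smult (lqj_scale n) (lqj_poly a p n)) \<le> n"
    using degree_lqj_poly by (rule order.trans[OF degree_smult_le])
  show "coeff (smult (lqj_scale n) (lqj_poly a p n)) n \<noteq> 0"
    using lqj_scale_sq[of n] by (auto simp: power2_eq_square)
  \<comment> \<open>By symmetry the smaller index may come first; its polynomial then has no term of
    degree \<open>k\<close> unless \<open>n = k\<close>.\<close>
  have *: "(\<lambda>m. (1 - q) * a ^ m * (poly (smult (lqj_scale n) (lqj_poly a p n)) (p ^ m) *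
              poly (smult (lqj_scale k) (lqj_poly a p k)) (p ^ m))) sums (if n = k then 1 else 0)"
    if "n \<le> k" for n k
  proof -
    have d: "degree (lqj_poly a p n) \<le> k" using degree_lqj_poly that by (rule order.trans)
    have c: "coeff (lqj_poly a p n) k = 0" if "n \<noteq> k"
      using that \<open>n \<le> k\<close> degree_lqj_poly[of a p n] by (intro coeff_eq_0) linarith
    have "(\<lambda>m. (1 - q) * lqj_scale n * lqj_scale k * (a ^ m * (poly (lqj_poly a p n) (p ^ m) * poly (lqj_poly a p k) (p ^ m))))
        sums ((1 - q) * lqj_scale n * lqj_scale k * (coeff (lqj_poly a p n) k * lqj_moment k k))"
      by (intro sums_mult lqj_poly_ip_sums d)
    moreover have "(1 - q) * lqj_scale n * lqj_scale k * (coeff (lqj_poly a p n) k * lqj_moment k k) = (if n = k then 1 else 0)"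
      using c lqj_scale_sq[of k] by (auto simp: power2_eq_square mult_ac)
    ultimately show ?thesis by (simp add: mult_ac)
  qed
  show "(\<Sum>m. (1 - q) * a ^ m * (poly (smult (lqj_scale n) (lqj_poly a p n)) (p ^ m) *
              poly (smult (lqj_scale k) (lqj_poly a p k)) (p ^ m))) = (if n = k then 1 else 0)"
  proof (cases "n \<le> k")
    case True
    then show ?thesis using sums_unique[OF *[of n k]] by simp
  next
    case False
    then show ?thesis using sums_unique[OF *[of k n]] by (simp add: mult_ac)
  qed
qed

section \<open>Approximable functions on the grid and the Fourier coefficients of the q-Bessel
  function\<close>

lemma ip_power: "ip (\<lambda>m. (p ^ m) ^ k) (e n) = (1 - q) * lqj_scale n * lqj_moment n k"
  using sums_unique[OF sums_mult[OF lqj_moment_sums, of "(1 - q) * lqj_scale n" k n]]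
  by (simp add: ip_def mult_ac)

text \<open>Since \<open>p ^ m\<close> is at most 1, the absolute series at \<open>t\<close> is a
  majorant for all grid points at once.\<close>

lemma qbessel_uniform_limit:
  "uniform_limit UNIV (\<lambda>K m. \<Sum>k<K. qbessel_coeff a q k * t ^ k * (p ^ m) ^ k) (\<lambda>m. f (p ^ m * t)) sequentially"
proof -
  have "uniform_limit UNIV (\<lambda>K m. \<Sum>k<K. qbessel_coeff a q k * t ^ k * (p ^ m) ^ k)
     (\<lambda>m. \<Sum>k. qbessel_coeff a q k * t ^ k * (p ^ m) ^ k) sequentially"
  proof (rule Weierstrass_m_test)
    fix k m
    have "(p ^ m) ^ k \<le> 1" using p by (intro power_le_one) auto
    then show "norm (qbessel_coeff a q k * t ^ k * (p ^ m) ^ k) \<le> \<bar>qbessel_coeff a q k * t ^ k\<bar>"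
      using p by (simp add: abs_mult mult_left_le)
  next
    have "summable (\<lambda>n. norm (qbessel_coeff a q n * t ^ n))"
      \<comment> \<open>Convergence at a point of larger modulus gives absolute convergence at
        \<open>t\<close>.\<close>
      by (rule powser_insidea[OF summable_qbessel[of "\<bar>t\<bar> + 1"]]) simp
    then show "summable (\<lambda>k. \<bar>qbessel_coeff a q k * t ^ k\<bar>)" by simp
  qed
  then show ?thesis by (simp add: qbessel_series_def power_mult_distrib mult_ac)
qed

lemma approximable_partial: "poly_approximable (\<lambda>m. p ^ m) (\<lambda>m. \<Sum>k<K. c k * (p ^ m) ^ k)"
  using poly_approximable_poly[of "\<lambda>m. p ^ m" "\<Sum>k<K. monom (c k) k"]
  by (simp add: poly_sum poly_monom)

lemma approximable_qbessel: "poly_approximable (\<lambda>m. p ^ m) (\<lambda>m. f (p ^ m * t))"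
  by (rule poly_approximable_uniform_limit[OF qbessel_uniform_limit approximable_partial])

text \<open>The product \<open>D\<close> vanishes at the finitely many points with
  \<open>m < k\<close> and is at most 1 in modulus for \<open>m > k\<close>, where the M-th power
  contributes at most \<open>p ^ M\<close>. Dividing by \<open>D k\<close> makes the value at
  \<open>k\<close> equal to 1.\<close>

lemma approximable_indicator: "poly_approximable (\<lambda>m. p ^ m) (\<lambda>m. if m = k then 1 else 0)"
proof -
  define D where "D m = (\<Prod>i<k. 1 - p ^ m * inverse (p ^ i))" for m
  define T where "T M m = inverse (D k) * (inverse (p ^ k) * p ^ m) ^ M * D m" for M m
  have Dk: "D k \<noteq> 0"
    using p by (auto simp: D_def field_simps power_inject_exp')
  have D0: "D m = 0" if "m < k" for m using that p by (auto simp: D_def intro!: bexI[of _ m])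
  have D1: "\<bar>D m\<bar> \<le> 1" if "k < m" for m
    unfolding D_def abs_prod
  proof (rule prod_le_1)
    fix i assume "i \<in> {..<k}"
    then have "p ^ m \<le> p ^ i" using that p by (intro power_decreasing) auto
    then show "0 \<le> \<bar>1 - p ^ m * inverse (p ^ i)\<bar> \<and> \<bar>1 - p ^ m * inverse (p ^ i)\<bar> \<le> 1"
      using p by (auto simp: field_simps abs_if)
  qed
  have b: "\<bar>T M m - (if m = k then 1 else 0)\<bar> \<le> \<bar>inverse (D k)\<bar> * p ^ M" if "M > 0" for M m
  proof (cases m k rule: linorder_cases)
    case less
    then show ?thesis using D0[OF less] p by (simp add: T_def)
  next
    case equal
    then show ?thesis using Dk p by (simp add: T_def)
  next
    case greater
    have "inverse (p ^ k) * p ^ m = p ^ (m - k)" using greater p by (simp add: power_diff field_simps)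
    then have "\<bar>T M m\<bar> = \<bar>inverse (D k)\<bar> * (p ^ (m - k)) ^ M * \<bar>D m\<bar>"
      using p by (simp add: T_def abs_mult)
    also have "\<dots> \<le> \<bar>inverse (D k)\<bar> * p ^ M * 1"
    proof (intro mult_mono D1 greater order.refl)
      have "p ^ (m - k) \<le> p ^ 1" using greater p by (intro power_decreasing) auto
      then show "(p ^ (m - k)) ^ M \<le> p ^ M" using p by (intro power_mono) auto
    qed (use p in auto)
    finally show ?thesis using greater by simp
  qed
  have lim: "uniform_limit UNIV T (\<lambda>m. if m = k then 1 else 0) sequentially"
  proof (rule uniform_limitI)
    fix \<epsilon> :: real assume "\<epsilon> > 0"
    have "(\<lambda>M. \<bar>inverse (D k)\<bar> * p ^ M) \<longlonglongrightarrow> \<bar>inverse (D k)\<bar> * 0"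
      using p by (intro tendsto_intros LIMSEQ_realpow_zero) auto
    then have "eventually (\<lambda>M. \<bar>inverse (D k)\<bar> * p ^ M < \<epsilon>) sequentially"
      using \<open>\<epsilon> > 0\<close> by (intro order_tendstoD) auto
    then show "eventually (\<lambda>M. \<forall>m\<in>UNIV. dist (T M m) (if m = k then 1 else 0) < \<epsilon>) sequentially"
      using eventually_gt_at_top[of 0]
      by eventually_elim (use b le_less_trans in \<open>unfold dist_real_def, blast\<close>)
  qed
  have "poly_approximable (\<lambda>m. p ^ m) (T M)" for M
    using poly_approximable_poly[of "\<lambda>m. p ^ m" "smult (inverse (D k) * inverse (p ^ k) ^ M)
        (monom 1 M * (\<Prod>i<k. [:1, - inverse (p ^ i):]))"]
    by (simp add: T_def[abs_def] D_def[of "_ :: nat"] poly_monom poly_prod power_mult_distrib mult_ac)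
  then show ?thesis by (rule poly_approximable_uniform_limit[OF lim])
qed

lemma ip_qbessel_sums:
  "(\<lambda>k. qbessel_coeff a q k * t ^ k * ((1 - q) * lqj_scale n * lqj_moment n k)) sums ip (\<lambda>m. f (p ^ m * t)) (e n)"
proof -
  have e: "poly_approximable (\<lambda>m. p ^ m) (e n)" by (rule poly_approximable_poly)
  have "ip (\<lambda>m. \<Sum>k<K. qbessel_coeff a q k * t ^ k * (p ^ m) ^ k) (e n) =
      (\<Sum>k<K. qbessel_coeff a q k * t ^ k * ((1 - q) * lqj_scale n * lqj_moment n k))" for K
  proof (induction K)
    case (Suc K)
    have pw: "poly_approximable (\<lambda>m. p ^ m) (\<lambda>m. (p ^ m) ^ K)"
      using poly_approximable_poly[of "\<lambda>m. p ^ m" "monom 1 K"] by (simp add: poly_monom)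
    have "ip (\<lambda>m. \<Sum>k<Suc K. qbessel_coeff a q k * t ^ k * (p ^ m) ^ k) (e n) =
        ip (\<lambda>m. \<Sum>k<K. qbessel_coeff a q k * t ^ k * (p ^ m) ^ k) (e n) +
        ip (\<lambda>m. (qbessel_coeff a q K * t ^ K) * (p ^ m) ^ K) (e n)"
      unfolding sum.lessThan_Suc
      by (rule ip_add[OF approximable_partial poly_approximable_cmult[OF pw] e])
    also have "ip (\<lambda>m. (qbessel_coeff a q K * t ^ K) * (p ^ m) ^ K) (e n) =
        (qbessel_coeff a q K * t ^ K) * ip (\<lambda>m. (p ^ m) ^ K) (e n)"
      by (rule ip_cmult[OF pw e])
    finally show ?case unfolding Suc.IH ip_power sum.lessThan_Suc .
  qed (simp add: ip_def)
  then show ?thesis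
    using ip_uniform_limit[OF qbessel_uniform_limit[of t] approximable_partial e]
    unfolding sums_def by (simp only:)
qed

text \<open>The moments below order \<open>n\<close> vanish, so the termwise series starts at
  \<open>k = n\<close>. Reindexed by \<open>k = i + n\<close> it is again a q-Bessel series, with
  parameter \<open>a * p ^ (2 * n + 1)\<close>, which corresponds to order \<nu> + 2n + 1.\<close>

lemma ip_qbessel:
  "ip (\<lambda>m. f (p ^ m * t)) (e n) =
     (1 - q) * lqj_scale n * t ^ n * q ^ (2 * n * n) * a ^ n * qpoch p p n / (qpoch a p n * qpoch a p (2 * n + 1)) *
     qbessel_series (a * p ^ (2 * n + 1)) q (p ^ n * t)"
proof -
  define a' where "a' = a * p ^ (2 * n + 1)"
  define K where "K = (1 - q) * lqj_scale n * t ^ n * q ^ (2 * n * n) * a ^ n * qpoch p p n / (qpoch a p n * qpoch a p (2 * n + 1))"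
  define u where "u k = qbessel_coeff a q k * t ^ k * ((1 - q) * lqj_scale n * lqj_moment n k)" for k
  interpret high: qbessel_params a' q p
    by unfold_locales
       (use q a p one_minus_pos(1)[of "2 * n + 1"] p_def in \<open>auto simp: a'_def\<close>)
  have "(\<Sum>k<n. u k) = 0" unfolding u_def by (intro sum.neutral) (auto simp: lqj_moment_eq_0)
  then have "(\<lambda>i. u (i + n)) sums ip (\<lambda>m. f (p ^ m * t)) (e n)"
    using ip_qbessel_sums[of t n] by (subst sums_iff_shift) (simp add: u_def[abs_def])
  moreover have "u (i + n) = K * (qbessel_coeff a' q i * (p ^ n * t) ^ i)" for i
  proof -
    have "(n + i) * (n + i + 1) = n * (n + 1) + i * (i + 1) + 2 * (n * i)"
      by (simp add: algebra_simps)
    then have q1: "q ^ ((n + i) * (n + i + 1)) = q ^ (n * (n + 1)) * q ^ (i * (i + 1)) * (p ^ n) ^ i"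
      by (simp only: power_add power_mult p_def)
    have "2 * n * n = n * (n + 1) + n * (n - 1)" by (cases n) simp_all
    then have q2: "q ^ (2 * n * n) = q ^ (n * (n + 1)) * q ^ (n * (n - 1))"
      by (simp only: power_add)
    \<comment> \<open>Both sides equal \<open>qpoch a p (2 * n + 1 + i)\<close>; regrouping at
      \<open>2 * n + 1\<close> produces the new parameter \<open>a'\<close>.\<close>
    have "qpoch a p (n + i) * qpoch (a * p ^ (n + i)) p (Suc n) = qpoch a p (2 * n + 1) * qpoch a' p i"
    proof -
      have "n + i + Suc n = 2 * n + 1 + i" by simp
      then show ?thesis unfolding a'_def qpoch_add[symmetric] by (rule arg_cong)
    qed
    then have A: "inverse (qpoch a p (n + i)) * inverse (qpoch (a * p ^ (n + i)) p (Suc n)) =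
        inverse (qpoch a p (2 * n + 1)) * inverse (qpoch a' p i)"
      by (simp only: inverse_mult_distrib[symmetric])
    have S: "(-1) ^ (n + i) * (-1) ^ n = ((-1) ^ i :: real)"
      by (simp add: power_add mult_ac flip: power_mult_distrib)
    have "u (i + n) = ((-1) ^ (n + i) * (-1) ^ n) * q ^ ((n + i) * (n + i + 1)) * t ^ (n + i) *
        (1 - q) * lqj_scale n * a ^ n * q ^ (n * (n - 1)) * qpoch p p n *
        (qpoch p p (n + i) * inverse (qpoch p p (n + i))) *
        (inverse (qpoch a p (n + i)) * inverse (qpoch (a * p ^ (n + i)) p (Suc n))) *
        inverse (qpoch a p n) * inverse (qpoch p p i)"
      unfolding u_def add.commute[of i n] lqj_moment_eq qbessel_coeff_def p_def[symmetric] divide_inverse inverse_mult_distrib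
      by (simp only: mult_ac)
    also have "qpoch p p (n + i) * inverse (qpoch p p (n + i)) = 1"
      using qpoch_p_pos[of "n + i"] by simp
    finally show ?thesis
      unfolding S A q1 K_def q2 qbessel_coeff_def p_def[symmetric] divide_inverse inverse_mult_distrib
        power_mult_distrib power_add[of t]
      by (simp only: mult_ac mult_1_left)
  qed
  ultimately have "(\<lambda>i. K * (qbessel_coeff a' q i * (p ^ n * t) ^ i)) sums ip (\<lambda>m. f (p ^ m * t)) (e n)"
    by simp
  then show ?thesis
    using sums_unique2 sums_mult[OF high.sums_f] unfolding K_def a'_def by blast
qed

end

section \<open>Expansion of the q-Bessel function\<close>

lemma (in qbessel_params) deriv_hahn_exton_J:
  assumes "a = q powr (2 * \<mu> + 2)" "x > 0"
  shows "deriv (hahn_exton_J q \<mu>) x =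
     qpoch_inf a p / qpoch_inf p p * x powr \<mu> * (\<mu> / x * f (x\<^sup>2) + 2 * x * deriv f (x\<^sup>2))"
proof -
  let ?C = "qpoch_inf a p / qpoch_inf p p"
  have "hahn_exton_J q \<mu> = (\<lambda>x. ?C * (x powr \<mu> * f (x\<^sup>2)))"
    by (simp add: fun_eq_iff hahn_exton_J_def norm_qbessel_eq assms(1) p_def)
  moreover have "((\<lambda>x. ?C * (x powr \<mu> * f (x\<^sup>2))) has_field_derivative
      ?C * (\<mu> * x powr (\<mu> - 1) * f (x\<^sup>2) + (deriv f (x\<^sup>2) * (2 * x)) * x powr \<mu>)) (at x)"
  proof (intro DERIV_cmult DERIV_mult)
    show "((\<lambda>x. x powr \<mu>) has_field_derivative \<mu> * x powr (\<mu> - 1)) (at x)"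
      using assms(2) by (rule has_real_derivative_powr)
    show "((\<lambda>x. f (x\<^sup>2)) has_field_derivative deriv f (x\<^sup>2) * (2 * x)) (at x)"
      by (rule DERIV_chain2[OF has_deriv_f]) (auto intro!: derivative_eq_intros)
  qed
  ultimately have "deriv (hahn_exton_J q \<mu>) x =
      ?C * (\<mu> * x powr (\<mu> - 1) * f (x\<^sup>2) + (deriv f (x\<^sup>2) * (2 * x)) * x powr \<mu>)"
    by (simp add: DERIV_imp_deriv)
  also have "x powr (\<mu> - 1) = x powr \<mu> / x"
    using assms(2) by (simp add: powr_diff)
  finally show ?thesis by (simp add: algebra_simps)
qed

lemma qgrid_pos: "0 < q \<Longrightarrow> y \<in> qgrid q \<Longrightarrow> y > 0"
  by (auto simp: qgrid_def)

lemma qgrid_unit_interval: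
  assumes "0 < q" "q < 1" "y \<in> {0..1} \<inter> qgrid q"
  obtains m :: nat where "y = q ^ m"
proof -
  obtain i :: int where i: "y = q powi i" and y: "y \<le> 1" using assms(3) by (auto simp: qgrid_def)
  have "i \<ge> 0"
  proof (rule ccontr)
    assume "\<not> i \<ge> 0"
    then have "q powi i = inverse (q ^ nat (- i))" "nat (- i) > 0"
      by (auto simp: power_int_def power_inverse)
    moreover have "q ^ nat (- i) < 1" using assms \<open>nat (- i) > 0\<close> by (simp add: power_less_one_iff)
    ultimately show False using i y assms(1) one_less_inverse[of "q ^ nat (- i)"] by simp
  qed
  then have "y = q ^ nat i" using i by (simp add: power_int_def)
  then show ?thesis by (rule that)
qed

section \<open>Identification of \<open>P_fun\<close> and \<open>J_fun\<close>, and the three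
  sums\<close>

context
  fixes q \<nu> a p :: real
  assumes q: "0 < q" "q < 1" and \<nu>: "\<nu> > -1"
    and a_def: "a = q powr (2 * \<nu> + 2)" and p_def: "p = q\<^sup>2"
begin

interpretation qbessel_contiguous a q p
proof
  show "0 < a" "a < 1" using q \<nu> powr01_less_one[of q "2 * \<nu> + 2"] by (auto simp: a_def)
qed (use q p_def in auto)

lemma powr_eqs:
  "q powr (2 * \<nu> + 4 * real n + 2) = a * p ^ (2 * n)"
  "q powr (2 + 2 * real n + 2 * \<nu>) = a * p ^ n"
  "q powr (2 * (\<nu> + 2 * real n + 1) + 2) = a * p ^ (2 * n + 1)"
  "q powr (2 * (\<nu> + 1) + 2) = a * p"
  "sqrt a = q powr (\<nu> + 1)"
proof -
  have pw: "p ^ k = q powr (2 * real k)" for k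
    using powr_realpow[OF q(1), of "2 * k"] by (simp add: p_def power_mult)
  show "q powr (2 * \<nu> + 4 * real n + 2) = a * p ^ (2 * n)"
    "q powr (2 + 2 * real n + 2 * \<nu>) = a * p ^ n"
    "q powr (2 * (\<nu> + 2 * real n + 1) + 2) = a * p ^ (2 * n + 1)"
    unfolding a_def pw powr_add[symmetric] by (rule arg_cong[of _ _ "(powr) q"], simp add: algebra_simps)+
  show "q powr (2 * (\<nu> + 1) + 2) = a * p"
    using pw[of 1] unfolding a_def by (simp add: algebra_simps flip: powr_add)
  show "sqrt a = q powr (\<nu> + 1)"
  proof (rule real_sqrt_unique)
    show "(q powr (\<nu> + 1))\<^sup>2 = a"
      using q by (simp add: a_def power2_eq_square algebra_simps flip: powr_add)
  qed simp
qed

lemma sigma_eq: "sigma_const q \<nu> n = sqrt ((1 - a * p ^ (2 * n)) / (1 - q))"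
  by (simp add: sigma_const_def powr_eqs)

lemma lqj_scale_eq: "lqj_scale n = sigma_const q \<nu> n * q powr (- real n * (\<nu> + 1)) * (qpoch a p n / qpoch p p n)"
proof -
  have "q powr (- real n * (\<nu> + 1)) = inverse ((q powr (\<nu> + 1)) powr real n)"
    by (simp add: powr_powr mult.commute flip: powr_minus)
  also have "\<dots> = 1 / sqrt a ^ n"
    using q by (simp add: powr_eqs powr_realpow divide_inverse)
  finally have "q powr (- real n * (\<nu> + 1)) = 1 / sqrt a ^ n" .
  then show ?thesis by (simp add: lqj_scale_def sigma_eq)
qed

lemma P_fun_grid: "P_fun q \<nu> n (q ^ m) = e n m"
proof -
  have p1: "q ^ (2 + 2 * n) = p * p ^ n" by (simp add: p_def power_add power_mult power2_eq_square)
  have "a = q powr (2 * \<nu>) * p"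
    unfolding a_def p_def powr_add using q by (simp flip: powr_numeral)
  then have L: "little_q_jacobi n ((q ^ m)\<^sup>2) (q powr (2 * \<nu>)) 1 p = poly (lqj_poly a p n) (p ^ m)"
    using little_q_jacobi_eq_poly[OF p(1), of a "q powr (2 * \<nu>)" n "(q ^ m)\<^sup>2"]
    by (simp add: p_def mult.commute flip: power_mult)
  have nz: "qpoch_inf (p * p ^ n) p \<noteq> 0" "qpoch_inf (a * p ^ n) p \<noteq> 0"
    using qpoch_inf_neq_0[OF p, of "p * p ^ n"] qpoch_inf_neq_0[OF p, of "a * p ^ n"] one_minus_pos[of n]
    by simp_all
  \<comment> \<open>Splitting off the first \<open>n\<close> factors makes the infinite tails
    cancel.\<close>
  have R: "qpoch_inf (p * p ^ n) p * qpoch_inf a p / (qpoch_inf (a * p ^ n) p * qpoch_inf p p) =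
      qpoch a p n / qpoch p p n"
    unfolding qpoch_inf_split[OF p, of a n] qpoch_inf_split[OF p, of p n] using nz by simp
  show ?thesis
    unfolding P_fun_def powr_eqs p1 p_def[symmetric] L a_def[symmetric] R poly_smult lqj_scale_eq ..
qed

text \<open>\<open>ip_qbessel\<close> already contains the Bessel series of order \<nu> + 2n + 1;
  what remains is to match constants and powers of \<open>q\<close> and \<open>l\<close>.\<close>

lemma J_fun_eq:
  assumes "l > 0"
  shows "J_fun q \<nu> n l = c_const q \<nu> * ip (\<lambda>m. f (p ^ m * l\<^sup>2)) (e n)"
proof -
  let ?a' = "a * p ^ (2 * n + 1)"
  define F where "F = qbessel_series ?a' q (p ^ n * l\<^sup>2)"
  have sq: "(q ^ n * l)\<^sup>2 = p ^ n * l\<^sup>2"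
    by (simp add: p_def power_mult_distrib mult.commute flip: power_mult)
  have pw: "(q ^ n * l) powr (\<nu> + 2 * real n + 1) / l powr (\<nu> + 1) = sqrt a ^ n * q ^ (2 * n * n) * (l\<^sup>2) ^ n"
  proof -
    have "l powr (\<nu> + 2 * real n + 1) = l powr (\<nu> + 1) * (l\<^sup>2) ^ n"
    proof -
      have "(l\<^sup>2) ^ n = l powr (2 * real n)"
        using powr_realpow[OF assms, of "2 * n"] by (simp add: power_mult)
      then show ?thesis by (simp add: algebra_simps flip: powr_add)
    qed
    moreover have "(q ^ n) powr (\<nu> + 2 * real n + 1) = sqrt a ^ n * q ^ (2 * n * n)"
    proof -
      have "sqrt a ^ n * q ^ (2 * n * n) = q powr ((\<nu> + 1) * real n) * q powr (2 * real n * real n)"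
        using powr_realpow[OF q(1), of "2 * n * n"] powr_realpow[of "sqrt a" n] q a
        by (simp add: powr_eqs powr_powr)
      also have "\<dots> = q powr (real n * (\<nu> + 2 * real n + 1))"
        by (simp add: algebra_simps flip: powr_add)
      finally show ?thesis using q by (simp add: powr_powr flip: powr_realpow)
    qed
    ultimately show ?thesis using assms q by (simp add: powr_mult)
  qed
  have "J_fun q \<nu> n l = sigma_const q \<nu> n * (qpoch_inf ?a' p / qpoch_inf p p) * F *
      ((q ^ n * l) powr (\<nu> + 2 * real n + 1) / l powr (\<nu> + 1))"
    unfolding J_fun_def hahn_exton_J_def norm_qbessel_eq powr_eqs sq p_def[symmetric] F_def
    by (simp only: divide_inverse mult_ac)
  also have "\<dots> = sigma_const q \<nu> n * (qpoch_inf ?a' p / qpoch_inf p p) * F *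
      (sqrt a ^ n * q ^ (2 * n * n) * (l\<^sup>2) ^ n)"
    unfolding pw ..
  finally have J: "J_fun q \<nu> n l = sigma_const q \<nu> n * (qpoch_inf ?a' p / qpoch_inf p p) * F *
      (sqrt a ^ n * q ^ (2 * n * n) * (l\<^sup>2) ^ n)" .
  have c: "c_const q \<nu> = 1 / (1 - q) * (qpoch a p (2 * n + 1) * qpoch_inf ?a' p / qpoch_inf p p)"
    unfolding c_const_def a_def[symmetric] p_def[symmetric] qpoch_inf_split[OF p, of a "2 * n + 1"] ..
  have an: "a ^ n = sqrt a ^ n * sqrt a ^ n"
    using a by (simp flip: power_mult_distrib)
  show ?thesis
  proof -
    \<comment> \<open>Here \<open>s\<close> stands for \<open>sqrt a ^ n\<close>, \<open>d\<close>
      for \<open>1 - q\<close>, and \<open>A\<close>, \<open>B\<close>, \<open>E\<close> for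
      \<open>qpoch a p (2 * n + 1)\<close>, \<open>qpoch a p n\<close>,
      \<open>qpoch p p n\<close>.\<close>
    have alg: "u * (v / y) * z * (s * b * t) =
        1 / d * (A * v / y) * (d * (u * (1 / s) * (B / E)) * t * b * (s * s) * E / (B * A) * z)"
      if "d \<noteq> 0" "s \<noteq> 0" "A \<noteq> 0" "B \<noteq> 0" "E \<noteq> 0" for u v y z s b t d A B E :: real
      using that by simp
    show ?thesis
      unfolding J c ip_qbessel F_def[symmetric] an
      unfolding lqj_scale_def sigma_eq
      using q a qpoch_a_pos[of n] qpoch_a_pos[of "2 * n + 1"] qpoch_p_pos[of n]
      by (intro alg) auto
  qed
qed

lemma c_norm_qbessel_grid:
  "c_const q \<nu> * norm_qbessel q \<nu> (l * q ^ m) = c_const q \<nu> * f (p ^ m * l\<^sup>2)"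
  by (simp add: norm_qbessel_eq a_def p_def power_mult_distrib mult_ac flip: power_mult)

lemma approximable_c_qbessel: "poly_approximable (\<lambda>m. p ^ m) (\<lambda>m. c_const q \<nu> * f (p ^ m * t))"
  by (intro poly_approximable_cmult approximable_qbessel)

lemma ip_c_qbessel:
  assumes "l > 0"
  shows "ip (\<lambda>m. c_const q \<nu> * f (p ^ m * l\<^sup>2)) (e n) = J_fun q \<nu> n l"
  unfolding J_fun_eq[OF assms] by (rule ip_cmult[OF approximable_qbessel poly_approximable_poly])

text \<open>Bilinear Parseval for the point mass at \<open>k\<close> and the scaled Bessel function;
  the weight of the point then divides out.\<close>

lemma J_P_sums:
  assumes "l > 0"
  shows "(\<lambda>n. J_fun q \<nu> n l * P_fun q \<nu> n (q ^ k)) sums (c_const q \<nu> * norm_qbessel q \<nu> (l * q ^ k))"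
proof -
  let ?w = "(1 - q) * a ^ k"
  have "(\<lambda>n. J_fun q \<nu> n l * (?w * P_fun q \<nu> n (q ^ k))) sums (?w * (c_const q \<nu> * norm_qbessel q \<nu> (l * q ^ k)))"
    using parseval_bilinear[OF approximable_indicator[of k] approximable_c_qbessel[of "l\<^sup>2"]]
    unfolding ip_c_qbessel[OF assms] ip_indicator c_norm_qbessel_grid
    unfolding P_fun_grid[symmetric]
    by (simp only: mult.commute)
  from sums_divide[OF this, of ?w] show ?thesis using q a by simp
qed

text \<open>The point mass at \<open>k\<close> has squared norm \<open>?w\<close> and Fourier
  coefficients \<open>?w * P_fun q \<nu> n (q ^ k)\<close>, so Parseval gives the value
  \<open>1 / ?w\<close>.\<close>

lemma P_square_sums:
  "(\<lambda>n. (P_fun q \<nu> n (q ^ k))\<^sup>2) sums ((q ^ k) powr (-2 * (\<nu> + 1)) / (1 - q))"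
proof -
  let ?w = "(1 - q) * a ^ k"
  have w: "?w \<noteq> 0" using q a by simp
  have "(\<lambda>n. (?w * P_fun q \<nu> n (q ^ k))\<^sup>2) sums ?w"
    using parseval[OF approximable_indicator[of k]]
    unfolding ip_indicator P_fun_grid[symmetric] by simp
  from sums_divide[OF this, of "?w\<^sup>2"]
  have "(\<lambda>n. (P_fun q \<nu> n (q ^ k))\<^sup>2) sums (?w / ?w\<^sup>2)"
    using w by (simp add: power_mult_distrib)
  moreover have "?w / ?w\<^sup>2 = (q ^ k) powr (-2 * (\<nu> + 1)) / (1 - q)"
  proof -
    have "a ^ k = (q ^ k) powr (2 * \<nu> + 2)"
      unfolding a_def using q by (simp add: powr_powr mult.commute flip: powr_realpow)
    moreover have "-2 * (\<nu> + 1) = - (2 * \<nu> + 2)" by simp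
    ultimately have "(q ^ k) powr (-2 * (\<nu> + 1)) = inverse (a ^ k)" by (simp only: powr_minus)
    moreover have "w / w\<^sup>2 = inverse w" for w :: real by (simp add: power2_eq_square field_simps)
    ultimately show ?thesis by (simp add: divide_inverse)
  qed
  ultimately show ?thesis by simp
qed

text \<open>Parseval for the scaled Bessel function, whose norm is known from
  \<open>qbessel_square_sums\<close>. The rest rewrites the bracket as a multiple of
  \<open>casoratian_deriv (l\<^sup>2)\<close>.\<close>

lemma J_square_sums:
  assumes l: "l > 0"
  shows "(\<lambda>n. (J_fun q \<nu> n l)\<^sup>2) sums
              (- (q powr \<nu> / (2 * (1 - q) * l powr (1 + 2 * \<nu>))) *
                 (l / q * hahn_exton_J q (\<nu> + 1) l * deriv (hahn_exton_J q \<nu>) (l / q)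
                  - hahn_exton_J q (\<nu> + 1) l * hahn_exton_J q \<nu> (l / q)
                  - l * deriv (hahn_exton_J q (\<nu> + 1)) l * hahn_exton_J q \<nu> (l / q)))"
    (is "_ sums ?R")
proof -
  define C where "C = qpoch_inf a p / qpoch_inf p p"
  define C' where "C' = qpoch_inf (a * p) p / qpoch_inf p p"
  define X where "X = l powr (\<nu> + 1)"
  define Y where "Y = (l / q) powr \<nu>"
  let ?h = "\<lambda>m. c_const q \<nu> * f (p ^ m * l\<^sup>2)"
  have lq: "l / q > 0" "(l / q)\<^sup>2 = l\<^sup>2 / p" using l q by (auto simp: p_def power_divide)
  have C: "C = (1 - a) * C'"
    unfolding C_def C'_def qpoch_inf_split[OF p, of a 1] by (simp add: qpoch_Suc)
  have J1: "hahn_exton_J q (\<nu> + 1) l = C' * X * g (l\<^sup>2)"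
    unfolding hahn_exton_J_def norm_qbessel_eq powr_eqs C'_def X_def p_def[symmetric] ..
  have J0: "hahn_exton_J q \<nu> (l / q) = C * Y * f (l\<^sup>2 / p)"
    unfolding hahn_exton_J_def norm_qbessel_eq a_def[symmetric] C_def Y_def p_def[symmetric] lq ..
  have D1: "deriv (hahn_exton_J q (\<nu> + 1)) l = C' * X * ((\<nu> + 1) / l * g (l\<^sup>2) + 2 * l * deriv g (l\<^sup>2))"
    unfolding C'_def X_def by (rule shifted.deriv_hahn_exton_J[OF powr_eqs(4)[symmetric] l])
  have D0: "deriv (hahn_exton_J q \<nu>) (l / q) =
      C * Y * (\<nu> / (l / q) * f (l\<^sup>2 / p) + 2 * (l / q) * deriv f (l\<^sup>2 / p))"
    unfolding C_def Y_def lq(2)[symmetric] using lq(1) by (intro deriv_hahn_exton_J a_def)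
  have XY: "q powr \<nu> * (X * Y) / l powr (1 + 2 * \<nu>) = 1"
  proof -
    have "q powr \<nu> * (X * Y) = l powr (\<nu> + 1) * l powr \<nu>"
      using q l by (simp add: X_def Y_def powr_divide)
    also have "\<dots> = l powr (1 + 2 * \<nu>)" by (simp add: algebra_simps flip: powr_add)
    finally show ?thesis using l by simp
  qed
  have "l / q * hahn_exton_J q (\<nu> + 1) l * deriv (hahn_exton_J q \<nu>) (l / q)
                  - hahn_exton_J q (\<nu> + 1) l * hahn_exton_J q \<nu> (l / q)
                  - l * deriv (hahn_exton_J q (\<nu> + 1)) l * hahn_exton_J q \<nu> (l / q)
      = 2 * (C * C') * (X * Y) * casoratian_deriv (l\<^sup>2)"
  proof -
    have e0: "l / q * (\<nu> / (l / q) * u + 2 * (l / q) * v) = \<nu> * u + 2 * (l\<^sup>2 * (v / p))" for u v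
      using l q by (simp add: p_def field_simps power2_eq_square)
    have e1: "l * ((\<nu> + 1) / l * u + 2 * l * v) = (\<nu> + 1) * u + 2 * (l\<^sup>2 * v)" for u v
      using l by (simp add: field_simps power2_eq_square)
    \<comment> \<open>Differentiating the powers of the argument contributes \<nu> and -(\<nu> + 1)
      times GF; with the middle term -GF this makes -2GF, so the common factor 2 comes out and the
      dependence on \<nu> cancels.\<close>
    have "l / q * (C' * X * G) * (C * Y * (\<nu> / (l / q) * F + 2 * (l / q) * F'))
         - (C' * X * G) * (C * Y * F) - l * (C' * X * ((\<nu> + 1) / l * G + 2 * l * G')) * (C * Y * F) =
       2 * (C * C') * (X * Y) * (l\<^sup>2 * G * (F' / p) - G * F - l\<^sup>2 * G' * F)" for F F' G G'
    proof -
      have "l / q * (C' * X * G) * (C * Y * (\<nu> / (l / q) * F + 2 * (l / q) * F'))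
         - (C' * X * G) * (C * Y * F) - l * (C' * X * ((\<nu> + 1) / l * G + 2 * l * G')) * (C * Y * F) =
       (C' * X * G) * (C * Y) * (l / q * (\<nu> / (l / q) * F + 2 * (l / q) * F')) - (C' * X * G) * (C * Y * F)
         - C' * X * (l * ((\<nu> + 1) / l * G + 2 * l * G')) * (C * Y * F)"
        by (simp only: mult_ac)
      then show ?thesis unfolding e0 e1 by (simp add: algebra_simps)
    qed
    then show ?thesis unfolding J1 J0 D1 D0 casoratian_deriv_eq .
  qed
  moreover have "- (u / (2 * d * v)) * (2 * r * s * k) = - (u * s / v) * (r * k) / d" for u d v r s k :: real
    by (simp add: mult_ac)
  ultimately have "?R = - (q powr \<nu> * (X * Y) / l powr (1 + 2 * \<nu>)) * (C * C' * casoratian_deriv (l\<^sup>2)) / (1 - q)"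
    by (simp only:)
  also have "\<dots> = - (C * C' * casoratian_deriv (l\<^sup>2)) / (1 - q)" unfolding XY by simp
  also have "\<dots> = ip ?h ?h"
  proof -
    have c: "c_const q \<nu> = C / (1 - q)"
      unfolding c_const_def a_def[symmetric] p_def[symmetric] C_def by simp
    have "(\<lambda>m. (1 - q) * (c_const q \<nu>)\<^sup>2 * (a ^ m * (f (p ^ m * l\<^sup>2))\<^sup>2)) sums
       ((1 - q) * (c_const q \<nu>)\<^sup>2 * (- casoratian_deriv (l\<^sup>2) / (1 - a)))"
      by (intro sums_mult qbessel_square_sums)
    then have "ip ?h ?h = (1 - q) * (c_const q \<nu>)\<^sup>2 * (- casoratian_deriv (l\<^sup>2) / (1 - a))"
      unfolding ip_def by (simp add: sums_iff power2_eq_square mult_ac)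
    also have "\<dots> = - (C * C' * casoratian_deriv (l\<^sup>2)) / (1 - q)"
    proof -
      have "d * (r / d)\<^sup>2 * (- k / b) = - (r * (r / b) * k) / d" if "d \<noteq> 0" for d r k b :: real
        using that by (simp add: power2_eq_square)
      then have "(1 - q) * (C / (1 - q))\<^sup>2 * (- casoratian_deriv (l\<^sup>2) / (1 - a)) =
          - (C * (C / (1 - a)) * casoratian_deriv (l\<^sup>2)) / (1 - q)"
        by this (use q in simp)
      \<comment> \<open>The factor 1/(1 - a) of the telescoped sum turns the square of
        \<open>C\<close> into the mixed product \<open>C * C'\<close> of the two Bessel
        normalizations.\<close>
      also have "C / (1 - a) = C'" unfolding C using a by simp
      finally show ?thesis unfolding c .
    qed
    finally show ?thesis ..
  qed
  finally show ?thesis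
    using parseval[OF approximable_c_qbessel[of "l\<^sup>2"]] unfolding ip_c_qbessel[OF l] by simp
qed

end

theorem proposition7:
  fixes q \<nu> :: real
  assumes "0 < q" and "q < 1" and "\<nu> > -1"
  shows "(\<forall>l\<in>qgrid q. \<forall>x\<in>{0..1} \<inter> qgrid q.
            (\<lambda>n. J_fun q \<nu> n l * P_fun q \<nu> n x) sums (c_const q \<nu> * norm_qbessel q \<nu> (l * x)))
       \<and> (\<forall>x\<in>{0..1} \<inter> qgrid q.
            (\<lambda>n. (P_fun q \<nu> n x)\<^sup>2) sums (x powr (-2 * (\<nu> + 1)) / (1 - q)))
       \<and> (\<forall>l\<in>qgrid q.
            (\<lambda>n. (J_fun q \<nu> n l)\<^sup>2) sums
              (- (q powr \<nu> / (2 * (1 - q) * l powr (1 + 2 * \<nu>))) *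
                 (l / q * hahn_exton_J q (\<nu> + 1) l * deriv (hahn_exton_J q \<nu>) (l / q)
                  - hahn_exton_J q (\<nu> + 1) l * hahn_exton_J q \<nu> (l / q)
                  - l * deriv (hahn_exton_J q (\<nu> + 1)) l * hahn_exton_J q \<nu> (l / q))))"
proof (intro conjI ballI)
  fix l x assume "l \<in> qgrid q" "x \<in> {0..1} \<inter> qgrid q"
  moreover from this obtain m where "x = q ^ m" using qgrid_unit_interval[OF assms(1,2)] by metis
  ultimately show "(\<lambda>n. J_fun q \<nu> n l * P_fun q \<nu> n x) sums (c_const q \<nu> * norm_qbessel q \<nu> (l * x))"
    using J_P_sums[OF assms refl refl] qgrid_pos[OF assms(1)] by simp
next
  fix x assume "x \<in> {0..1} \<inter> qgrid q"
  then obtain m where "x = q ^ m" using qgrid_unit_interval[OF assms(1,2)] by metis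
  then show "(\<lambda>n. (P_fun q \<nu> n x)\<^sup>2) sums (x powr (-2 * (\<nu> + 1)) / (1 - q))"
    using P_square_sums[OF assms refl refl] by simp
next
  fix l assume "l \<in> qgrid q"
  then show "(\<lambda>n. (J_fun q \<nu> n l)\<^sup>2) sums
              (- (q powr \<nu> / (2 * (1 - q) * l powr (1 + 2 * \<nu>))) *
                 (l / q * hahn_exton_J q (\<nu> + 1) l * deriv (hahn_exton_J q \<nu>) (l / q)
                  - hahn_exton_J q (\<nu> + 1) l * hahn_exton_J q \<nu> (l / q)
                  - l * deriv (hahn_exton_J q (\<nu> + 1)) l * hahn_exton_J q \<nu> (l / q)))"
    by (intro J_square_sums[OF assms refl refl] qgrid_pos[OF assms(1)])
qed

end
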